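(* Consider the system $$\partial_t\rho+\partial_r(\rho u)+\tfrac{n-1}{r}\rho u=0,\qquad \partial_t(\rho u)+\partial_r(\rho u^2)+\tfrac{n-1}{r}\rho u^2=0 .\qquad(\ast)$$ Let $R>0$, let $(\rho_0,u_0)$ and $(\rho_1,u_1)$, with $\rho_0,\rho_1\ge0$, be classical solutions of $(\ast)$ in the regions $r<R+v_0t$ and $r>R+v_0t$ respectively, where $v_0$ is one of the (constant) roots $${}_1v_0=\frac{u_1\sqrt{\rho_1}+u_0\sqrt{\rho_0}}{\sqrt{\rho_1}+\sqrt{\rho_0}},\qquad {}_2v_0=\frac{u_1\sqrt{\rho_1}-u_0\sqrt{\rho_0}}{\sqrt{\rho_1}-\sqrt{\rho_0}}$$ (only the first one if $\rho_0=\rho_1$), and assume $\kappa_2\neq0$. Consider the shadow wave solution of constant wave speed $v_0$ given for $\varepsilon>0$ by $$\big(\rho^\varepsilon_{sw},u^\varepsilon_{sw}\big)(r,t)=\begin{cases}(\rho_0,u_0), & r<R+v_0t-\tfrac\varepsilon2,\\ \big(\tfrac1\varepsilon\sigma(t),\,v_0\big), & R+v_0t-\tfrac\varepsilon2<r<R+v_0t+\tfrac\varepsilon2,\\ (\rho_1,u_1), & r>R+v_0t+\tfrac\varepsilon2,\end{cases}$$ $$\sigma(t)=\frac1{v_0}\int_R^{R+v_0t}\kappa_1(r)\,r^{n-1}\,dr\cdot(R+v_0t)^{1-n}.$$ This shadow wave solution is physical and dissipative if and only if $$v_0={}_1v_0=\frac{u_1\sqrt{\rho_1}+u_0\sqrt{\rho_0}}{\sqrt{\rho_1}+\sqrt{\rho_0}}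 .$$ Further, if $\rho_0>0$ and $\rho_1>0$, then necessarily $u_0\ge u_1$ and the dissipativity condition $$u_0u_1\kappa_1\le(u_0+u_1-v_0)\kappa_2$$ is equivalent to the overcompressibility condition $$u_0\ge v_0\ge u_1 .$$
   Context: Here $n$ is the space dimension, $r>0$ the radial variable, $t\ge0$ time, and the front $r=R+v_0t$ is considered as long as $R+v_0t>0$. Jump notation: $[f]=f_1-f_0$, where $f_0,f_1$ are formed from $(\rho_0,u_0)$ and $(\rho_1,u_1)$ and evaluated on the front; the states $\rho_i,u_i$ in the formulas for the roots and in the inequalities are also evaluated on the front. Set $$\kappa_1=v_0[\rho]-[\rho u],\qquad \kappa_2=v_0[\rho u]-[\rho u^2],$$ regarded as functions of the front position $r=R+v_0t$. The roots ${}_1v_0,{}_2v_0$ are the solutions of $v_0\kappa_1=\kappa_2$; hence $\kappa_2\ne0$ implies $v_0\neq0$ and $\kappa_1\ne0$. The shadow wave is called physical if $\sigma(t)\ge0$ on its interval of existence. It is called dissipative if $$\lim_{\varepsilon\to0}\Big(\partial_t\big(\tfrac12\rho^\varepsilon_{sw}(u^\varepsilon_{sw})^2\big)+\partial_r\big(\tfrac12\rho^\varepsilon_{sw}(u^\varepsilon_{sw})^3\big)+\tfrac{n-1}{2r}\rho^\varepsilon_{sw}(u^\varepsilon_{sw})^3\Big)\le0$$ in the weak sense, i.e. when applied to nonnegative test functions. For a shadow wave of constant speed $v_0$ this is equivalent to $u_0u_1\kappa_1\le(u_0+u_1-v_0)\kappa_2$ on the front.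
   Formalization: As v₀=₁v₀ with u₀<u₁ gives σ<0 (not physical), the first equivalence has v₀=₁v₀ together with u₀≥u₁; u₀≥u₁ is claimed for physical dissipative waves, and the equivalence with overcompressibility only if the wave is physical or v₀=₁v₀, as it fails for ₂v₀ with σ<0. *)

theory Defs
  imports "HOL-Analysis.Analysis"
begin

text \<open>
  A field is a function of the radial variable r and the time t, in this order.
  The front is the curve r = R + v t, considered for those t \<ge> 0 with R + v t > 0.
\<close>

type_synonym field = "real \<Rightarrow> real \<Rightarrow> real"

definition front_times :: "real \<Rightarrow> real \<Rightarrow> real set" where
  "front_times R v = {t. 0 \<le> t \<and> 0 < R + v * t}"

definition domain_of_front :: "real \<Rightarrow> real \<Rightarrow> (real \<times> real) set" where
  "domain_of_front R v = {(r, t). 0 < r \<and> 0 < t \<and> 0 < R + v * t}"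

definition left_region :: "real \<Rightarrow> real \<Rightarrow> (real \<times> real) set" where
  "left_region R v = {(r, t) \<in> domain_of_front R v. r < R + v * t}"

definition right_region :: "real \<Rightarrow> real \<Rightarrow> (real \<times> real) set" where
  "right_region R v = {(r, t) \<in> domain_of_front R v. r > R + v * t}"

text \<open>The regions together with the front and the initial line t = 0.\<close>

definition left_region_closed :: "real \<Rightarrow> real \<Rightarrow> (real \<times> real) set" where
  "left_region_closed R v = {(r, t). 0 < r \<and> t \<in> front_times R v \<and> r \<le> R + v * t}"

definition right_region_closed :: "real \<Rightarrow> real \<Rightarrow> (real \<times> real) set" where
  "right_region_closed R v = {(r, t). t \<in> front_times R v \<and> R + v * t \<le> r}"


definition C1_on :: "(real \<times> real) set \<Rightarrow> field \<Rightarrow> bool" where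
  "C1_on S f \<longleftrightarrow>
     (\<exists>f\<^sub>r f\<^sub>t.
        (\<forall>(r, t)\<in>S. ((\<lambda>x. f x t) has_real_derivative f\<^sub>r r t) (at r) \<and>
                    ((\<lambda>s. f r s) has_real_derivative f\<^sub>t r t) (at t)) \<and>
        continuous_on S (\<lambda>(r, t). f\<^sub>r r t) \<and> continuous_on S (\<lambda>(r, t). f\<^sub>t r t))"

definition classical_solution ::
    "nat \<Rightarrow> (real \<times> real) set \<Rightarrow> field \<Rightarrow> field \<Rightarrow> bool" where
  "classical_solution n S \<rho> u \<longleftrightarrow>
     C1_on S \<rho> \<and> C1_on S u \<and>
     (\<forall>(r, t)\<in>S.
        deriv (\<lambda>s. \<rho> r s) t + deriv (\<lambda>x. \<rho> x t * u x t) r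
          + (real n - 1) / r * (\<rho> r t * u r t) = 0 \<and>
        deriv (\<lambda>s. \<rho> r s * u r s) t + deriv (\<lambda>x. \<rho> x t * (u x t)\<^sup>2) r
          + (real n - 1) / r * (\<rho> r t * (u r t)\<^sup>2) = 0)"

text \<open>
  A classical state on one side of the front. Values on the front are meaningful because the
  fields are continuous up to it.
\<close>

definition state_on ::
    "nat \<Rightarrow> (real \<times> real) set \<Rightarrow> (real \<times> real) set \<Rightarrow> field \<Rightarrow> field \<Rightarrow> bool" where
  "state_on n S S' \<rho> u \<longleftrightarrow>
     classical_solution n S \<rho> u \<and>
     continuous_on S' (\<lambda>(r, t). \<rho> r t) \<and> continuous_on S' (\<lambda>(r, t). u r t) \<and>
     (\<forall>(r, t)\<in>S'. 0 \<le> \<rho> r t)"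


definition on_front :: "real \<Rightarrow> real \<Rightarrow> field \<Rightarrow> real \<Rightarrow> real" where
  "on_front R v f t = f (R + v * t) t"

definition first_root :: "real \<Rightarrow> real \<Rightarrow> real \<Rightarrow> real \<Rightarrow> real" where
  "first_root \<rho>\<^sub>0 u\<^sub>0 \<rho>\<^sub>1 u\<^sub>1 = (u\<^sub>1 * sqrt \<rho>\<^sub>1 + u\<^sub>0 * sqrt \<rho>\<^sub>0) / (sqrt \<rho>\<^sub>1 + sqrt \<rho>\<^sub>0)"

definition second_root :: "real \<Rightarrow> real \<Rightarrow> real \<Rightarrow> real \<Rightarrow> real" where
  "second_root \<rho>\<^sub>0 u\<^sub>0 \<rho>\<^sub>1 u\<^sub>1 = (u\<^sub>1 * sqrt \<rho>\<^sub>1 - u\<^sub>0 * sqrt \<rho>\<^sub>0) / (sqrt \<rho>\<^sub>1 - sqrt \<rho>\<^sub>0)"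

definition is_first_root :: "real \<Rightarrow> real \<Rightarrow> field \<Rightarrow> field \<Rightarrow> field \<Rightarrow> field \<Rightarrow> bool" where
  "is_first_root R v \<rho>\<^sub>0 u\<^sub>0 \<rho>\<^sub>1 u\<^sub>1 \<longleftrightarrow>
     (\<forall>t\<in>front_times R v.
        v = first_root (on_front R v \<rho>\<^sub>0 t) (on_front R v u\<^sub>0 t)
                       (on_front R v \<rho>\<^sub>1 t) (on_front R v u\<^sub>1 t))"

definition is_second_root :: "real \<Rightarrow> real \<Rightarrow> field \<Rightarrow> field \<Rightarrow> field \<Rightarrow> field \<Rightarrow> bool" where
  "is_second_root R v \<rho>\<^sub>0 u\<^sub>0 \<rho>\<^sub>1 u\<^sub>1 \<longleftrightarrow>
     (\<forall>t\<in>front_times R v.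
        on_front R v \<rho>\<^sub>0 t \<noteq> on_front R v \<rho>\<^sub>1 t \<and>
        v = second_root (on_front R v \<rho>\<^sub>0 t) (on_front R v u\<^sub>0 t)
                        (on_front R v \<rho>\<^sub>1 t) (on_front R v u\<^sub>1 t))"

text \<open>
  The functions kappa1 and kappa2 of the front position are written as functions of the time t
  at which the front is at R + v t; for v \<noteq> 0 it is at position r at the time (r - R) / v.
\<close>

definition jump :: "real \<Rightarrow> real \<Rightarrow> field \<Rightarrow> field \<Rightarrow> real \<Rightarrow> real" where
  "jump R v f\<^sub>0 f\<^sub>1 t = on_front R v f\<^sub>1 t - on_front R v f\<^sub>0 t"

definition kappa1 :: "real \<Rightarrow> real \<Rightarrow> field \<Rightarrow> field \<Rightarrow> field \<Rightarrow> field \<Rightarrow> real \<Rightarrow> real" where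
  "kappa1 R v \<rho>\<^sub>0 u\<^sub>0 \<rho>\<^sub>1 u\<^sub>1 t =
     v * jump R v \<rho>\<^sub>0 \<rho>\<^sub>1 t
       - jump R v (\<lambda>r s. \<rho>\<^sub>0 r s * u\<^sub>0 r s) (\<lambda>r s. \<rho>\<^sub>1 r s * u\<^sub>1 r s) t"

definition kappa2 :: "real \<Rightarrow> real \<Rightarrow> field \<Rightarrow> field \<Rightarrow> field \<Rightarrow> field \<Rightarrow> real \<Rightarrow> real" where
  "kappa2 R v \<rho>\<^sub>0 u\<^sub>0 \<rho>\<^sub>1 u\<^sub>1 t =
     v * jump R v (\<lambda>r s. \<rho>\<^sub>0 r s * u\<^sub>0 r s) (\<lambda>r s. \<rho>\<^sub>1 r s * u\<^sub>1 r s) t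
       - jump R v (\<lambda>r s. \<rho>\<^sub>0 r s * (u\<^sub>0 r s)\<^sup>2) (\<lambda>r s. \<rho>\<^sub>1 r s * (u\<^sub>1 r s)\<^sup>2) t"

text \<open>The interval integral is oriented, so a front moving inwards (v < 0) is covered.\<close>

definition shadow_strength ::
    "nat \<Rightarrow> real \<Rightarrow> real \<Rightarrow> field \<Rightarrow> field \<Rightarrow> field \<Rightarrow> field \<Rightarrow> real \<Rightarrow> real" where
  "shadow_strength n R v \<rho>\<^sub>0 u\<^sub>0 \<rho>\<^sub>1 u\<^sub>1 t =
     1 / v * (LBINT r=R..R + v * t. kappa1 R v \<rho>\<^sub>0 u\<^sub>0 \<rho>\<^sub>1 u\<^sub>1 ((r - R) / v) * r ^ (n - 1))
       * (R + v * t) powi (1 - int n)"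

definition shadow_density ::
    "nat \<Rightarrow> real \<Rightarrow> real \<Rightarrow> field \<Rightarrow> field \<Rightarrow> field \<Rightarrow> field \<Rightarrow> real \<Rightarrow> field" where
  "shadow_density n R v \<rho>\<^sub>0 u\<^sub>0 \<rho>\<^sub>1 u\<^sub>1 \<epsilon> r t =
     (if r < R + v * t - \<epsilon> / 2 then \<rho>\<^sub>0 r t
      else if r < R + v * t + \<epsilon> / 2 then 1 / \<epsilon> * shadow_strength n R v \<rho>\<^sub>0 u\<^sub>0 \<rho>\<^sub>1 u\<^sub>1 t
      else \<rho>\<^sub>1 r t)"

definition shadow_velocity ::
    "real \<Rightarrow> real \<Rightarrow> field \<Rightarrow> field \<Rightarrow> real \<Rightarrow> field" where
  "shadow_velocity R v u\<^sub>0 u\<^sub>1 \<epsilon> r t =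
     (if r < R + v * t - \<epsilon> / 2 then u\<^sub>0 r t
      else if r < R + v * t + \<epsilon> / 2 then v
      else u\<^sub>1 r t)"

definition physical ::
    "nat \<Rightarrow> real \<Rightarrow> real \<Rightarrow> field \<Rightarrow> field \<Rightarrow> field \<Rightarrow> field \<Rightarrow> bool" where
  "physical n R v \<rho>\<^sub>0 u\<^sub>0 \<rho>\<^sub>1 u\<^sub>1 \<longleftrightarrow>
     (\<forall>t\<in>front_times R v. 0 \<le> shadow_strength n R v \<rho>\<^sub>0 u\<^sub>0 \<rho>\<^sub>1 u\<^sub>1 t)"


text \<open>
  Smoothness through the family of all mixed partial derivatives: D i j is the derivative of
  order i in r and of order j in t.
\<close>

definition smooth_field :: "field \<Rightarrow> bool" where
  "smooth_field \<phi> \<longleftrightarrow>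
     (\<exists>D :: nat \<Rightarrow> nat \<Rightarrow> field. D 0 0 = \<phi> \<and>
        (\<forall>i j. continuous_on UNIV (\<lambda>(r, t). D i j r t) \<and>
           (\<forall>r t. ((\<lambda>x. D i j x t) has_real_derivative D (Suc i) j r t) (at r) \<and>
                  ((\<lambda>s. D i j r s) has_real_derivative D i (Suc j) r t) (at t))))"

definition test_function :: "(real \<times> real) set \<Rightarrow> field \<Rightarrow> bool" where
  "test_function S \<phi> \<longleftrightarrow>
     smooth_field \<phi> \<and> (\<exists>K. compact K \<and> K \<subseteq> S \<and> (\<forall>r t. (r, t) \<notin> K \<longrightarrow> \<phi> r t = 0))"

text \<open>
  The value on the test function \<phi> of the distribution
  \<partial>_t (\<rho> u^2 / 2) + \<partial>_r (\<rho> u^3 / 2) + (n - 1) / (2 r) \<rho> u^3 on S.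
\<close>

definition weak_energy_production ::
    "nat \<Rightarrow> (real \<times> real) set \<Rightarrow> field \<Rightarrow> field \<Rightarrow> field \<Rightarrow> real" where
  "weak_energy_production n S \<rho> u \<phi> =
     (LINT p:S|lborel. case p of (r, t) \<Rightarrow>
        - (1 / 2 * \<rho> r t * (u r t)^2) * deriv (\<lambda>s. \<phi> r s) t
        - (1 / 2 * \<rho> r t * (u r t)^3) * deriv (\<lambda>x. \<phi> x t) r
        + (real n - 1) / (2 * r) * \<rho> r t * (u r t)^3 * \<phi> r t)"

definition dissipative ::
    "nat \<Rightarrow> real \<Rightarrow> real \<Rightarrow> field \<Rightarrow> field \<Rightarrow> field \<Rightarrow> field \<Rightarrow> bool" where
  "dissipative n R v \<rho>\<^sub>0 u\<^sub>0 \<rho>\<^sub>1 u\<^sub>1 \<longleftrightarrow>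
     (\<forall>\<phi>. test_function (domain_of_front R v) \<phi> \<and> (\<forall>r t. 0 \<le> \<phi> r t) \<longrightarrow>
        (\<exists>L\<le>0.
           ((\<lambda>\<epsilon>. weak_energy_production n (domain_of_front R v)
                   (shadow_density n R v \<rho>\<^sub>0 u\<^sub>0 \<rho>\<^sub>1 u\<^sub>1 \<epsilon>) (shadow_velocity R v u\<^sub>0 u\<^sub>1 \<epsilon>) \<phi>)
             \<longlongrightarrow> L) (at_right 0)))"


definition dissipativity_condition ::
    "real \<Rightarrow> real \<Rightarrow> field \<Rightarrow> field \<Rightarrow> field \<Rightarrow> field \<Rightarrow> real \<Rightarrow> bool" where
  "dissipativity_condition R v \<rho>\<^sub>0 u\<^sub>0 \<rho>\<^sub>1 u\<^sub>1 t \<longleftrightarrow>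
     on_front R v u\<^sub>0 t * on_front R v u\<^sub>1 t * kappa1 R v \<rho>\<^sub>0 u\<^sub>0 \<rho>\<^sub>1 u\<^sub>1 t
       \<le> (on_front R v u\<^sub>0 t + on_front R v u\<^sub>1 t - v) * kappa2 R v \<rho>\<^sub>0 u\<^sub>0 \<rho>\<^sub>1 u\<^sub>1 t"

definition overcompressive ::
    "real \<Rightarrow> real \<Rightarrow> field \<Rightarrow> field \<Rightarrow> real \<Rightarrow> bool" where
  "overcompressive R v u\<^sub>0 u\<^sub>1 t \<longleftrightarrow> on_front R v u\<^sub>0 t \<ge> v \<and> v \<ge> on_front R v u\<^sub>1 t"

end

theory Submission
  imports Defs "HOL-Computational_Algebra.Polynomial"
begin

text \<open>
  At both roots \<open>\<kappa>\<^sub>2 = v\<^sub>0 \<kappa>\<^sub>1\<close>, so the jump of the energy flux factors: the limit of the weak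
  energy production is one half of the integral of the test function along the front against
  \<open>(v\<^sub>0 - u\<^sub>0) (v\<^sub>0 - u\<^sub>1) \<kappa>\<^sub>1\<close>. At the first root the product of the two differences is negative
  and \<open>\<kappa>\<^sub>1 = sqrt (\<rho>\<^sub>0 \<rho>\<^sub>1) (u\<^sub>0 - u\<^sub>1)\<close>; at the second root it is positive and
  \<open>\<kappa>\<^sub>1 = sqrt (\<rho>\<^sub>0 \<rho>\<^sub>1) (u\<^sub>1 - u\<^sub>0)\<close>. Since \<open>\<kappa>\<^sub>1\<close> never vanishes it has a constant sign, and
  the shadow wave is physical precisely when that sign is positive.

  The limit is computed in the frame moving with the front. The derivatives of a classical
  solution may blow up at the front, but for every \<open>\<epsilon> > 0\<close> the divergence theorem applies on
  \<open>r < R + v\<^sub>0 t - \<epsilon> / 2\<close> and on \<open>r > R + v\<^sub>0 t + \<epsilon> / 2\<close> and leaves boundary fluxes that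
  depend continuously on \<open>\<epsilon>\<close>.
\<close>

subsection \<open>Smooth bump functions\<close>

text \<open>The factor (n - 1) / r leaves no trace in the limit. In the outer regions it is absorbed
  by the energy balance. Inside the strip it meets the growth law of the strength, whose factor r^(1
  - n) contributes -(n - 1) v / (R + v t) times the strength, and the two terms cancel. Nothing is
  known about the states or the strength at r \<le> 0, at negative times, or after the front has
  reached the origin. A test function has compact support in the open domain, so fields are
  multiplied by it and the products extend by zero; all integrals can then be taken over boxes of a
  size fixed by the support. Bump functions serve only the failure of dissipativity at the second
  root, where one nonnegative test function has to detect a density that is positive along the
  front.\<close>

definition smooth_real :: "(real \<Rightarrow> real) \<Rightarrow> bool" where
  "smooth_real f \<longleftrightarrow>
     (\<exists>D :: nat \<Rightarrow> real \<Rightarrow> real. D 0 = f \<and> (\<forall>k x. (D k has_real_derivative D (Suc k) x) (at x)))"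

lemma smooth_real_affine:
  assumes "smooth_real f"
  shows "smooth_real (\<lambda>x. f (a * x + b))"
proof -
  obtain D where D: "D 0 = f" "\<And>k x. (D k has_real_derivative D (Suc k) x) (at x)"
    using assms unfolding smooth_real_def by blast
  have "((\<lambda>x. a ^ k * D k (a * x + b)) has_real_derivative a ^ Suc k * D (Suc k) (a * x + b)) (at x)"
    for k x
    by (rule derivative_eq_intros DERIV_chain2[OF D(2)] refl)+ simp
  then show ?thesis
    unfolding smooth_real_def
    by (intro exI[of _ "\<lambda>k x. a ^ k * D k (a * x + b)"]) (simp add: D(1))
qed

lemma smooth_real_mult:
  assumes "smooth_real f" and "smooth_real g"
  shows "smooth_real (\<lambda>x. f x * g x)"
proof -
  obtain F G where F: "F 0 = f" "\<And>k x. (F k has_real_derivative F (Suc k) x) (at x)"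
    and G: "G 0 = g" "\<And>k x. (G k has_real_derivative G (Suc k) x) (at x)"
    using assms unfolding smooth_real_def by blast
  text \<open>Iterating the product rule on lists of index pairs avoids binomial coefficients.\<close>
  define h where "h l x = (\<Sum>(i, j)\<leftarrow>l. F i x * G j x)" for l x
  define d where "d l = concat (map (\<lambda>(i, j). [(Suc i, j), (i, Suc j)]) l)" for l :: "(nat \<times> nat) list"
  have h: "(h l has_real_derivative h (d l) x) (at x)" for l x
  proof (induction l)
    case Nil
    then show ?case by (simp add: h_def d_def)
  next
    case (Cons p l)
    obtain i j where p: "p = (i, j)" by (cases p)
    have "((\<lambda>x. F i x * G j x + h l x) has_real_derivative
        F (Suc i) x * G j x + F i x * G (Suc j) x + h (d l) x) (at x)"
      by (rule derivative_eq_intros F(2) G(2) Cons.IH refl)+ simp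
    moreover have "h (p # l) = (\<lambda>x. F i x * G j x + h l x)"
      and "h (d (p # l)) x = F (Suc i) x * G j x + F i x * G (Suc j) x + h (d l) x"
      by (auto simp: h_def d_def p)
    ultimately show ?case by simp
  qed
  have "h [(0, 0)] = (\<lambda>x. f x * g x)"
    by (simp add: h_def F(1) G(1) fun_eq_iff)
  then show ?thesis
    unfolding smooth_real_def
    by (intro exI[of _ "\<lambda>k. h ((d ^^ k) [(0, 0)])"]) (simp add: h)
qed

lemma tendsto_poly_times_exp_0: "((\<lambda>x. poly p x * exp (- x)) \<longlongrightarrow> (0::real)) at_top"
proof -
  have "((\<lambda>x. \<Sum>i\<le>degree p. coeff p i * (x ^ i / exp x)) \<longlongrightarrow> (\<Sum>i\<le>degree p. coeff p i * 0)) at_top"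
    by (intro tendsto_intros tendsto_power_div_exp_0)
  then show ?thesis
    by (simp add: poly_altdef exp_minus sum_distrib_right divide_inverse mult.assoc)
qed

text \<open>With y = 1 / x and dy/dx = - y^2, the derivative of p(y) exp(- y) is y^2 (p(y) - p'(y))
  exp(- y); \<open>[:0, 0, 1:]\<close> is the factor y^2.\<close>

primrec flat_poly :: "nat \<Rightarrow> real poly" where
  "flat_poly 0 = 1"
| "flat_poly (Suc k) = [:0, 0, 1:] * (flat_poly k - pderiv (flat_poly k))"

text \<open>The derivatives of the function that is exp (- 1 / x) for x > 0 and 0 otherwise.\<close>

definition flat :: "nat \<Rightarrow> real \<Rightarrow> real" where
  "flat k x = (if x \<le> 0 then 0 else poly (flat_poly k) (1 / x) * exp (- (1 / x)))"

lemma DERIV_flat: "(flat k has_real_derivative flat (Suc k) x) (at x)"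
proof -
  consider "x < 0" | "x = 0" | "x > 0" by linarith
  then show ?thesis
  proof cases
    case 1
    have "((\<lambda>_. 0) has_real_derivative 0) (at x)" by simp
    then have "(flat k has_real_derivative 0) (at x)"
      by (rule has_field_derivative_transform_within_open[where S = "{..<0}"])
        (use 1 in \<open>auto simp: flat_def\<close>)
    then show ?thesis using 1 by (simp add: flat_def)
  next
    case 2
    \<comment> \<open>\<open>pCons 0\<close> multiplies the polynomial by its variable, here
      \<open>1 / h\<close>, and so supplies the denominator of the difference quotient at 0.\<close>
    have "((\<lambda>h. poly (pCons 0 (flat_poly k)) (inverse h) * exp (- inverse h)) \<longlongrightarrow> 0) (at_right 0)"
      by (rule filterlim_compose[OF tendsto_poly_times_exp_0 filterlim_inverse_at_top_right])
    moreover have "\<forall>\<^sub>F h in at_right 0.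
        poly (pCons 0 (flat_poly k)) (inverse h) * exp (- inverse h) = flat k h / h"
      by (rule eventually_at_right_less[THEN eventually_mono]) (auto simp: flat_def divide_inverse)
    ultimately have "((\<lambda>h. flat k h / h) \<longlongrightarrow> 0) (at_right 0)"
      by (rule Lim_transform_eventually)
    moreover have "((\<lambda>h. flat k h / h) \<longlongrightarrow> 0) (at_left 0)"
    proof (rule Lim_transform_eventually[OF tendsto_const])
      show "\<forall>\<^sub>F h in at_left 0. 0 = flat k h / h"
        by (auto simp: flat_def eventually_at_filter)
    qed
    ultimately have "((\<lambda>h. flat k h / h) \<longlongrightarrow> 0) (at 0)"
      by (simp add: filterlim_split_at)
    then show ?thesis
      by (simp add: 2 DERIV_def flat_def)
  next
    case 3
    have "((\<lambda>x. poly (flat_poly k) (1 / x) * exp (- (1 / x))) has_real_derivative flat (Suc k) x) (at x)"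
      using 3
      by (auto intro!: derivative_eq_intros DERIV_chain2[OF poly_DERIV]
          simp: flat_def algebra_simps power2_eq_square)
    then show ?thesis
      by (rule has_field_derivative_transform_within_open[where S = "{0<..}"])
        (use 3 in \<open>auto simp: flat_def\<close>)
  qed
qed

text \<open>The witness is exp(- 1 / (x - a)) exp(- 1 / (b - x)) between \<open>a\<close> and
  \<open>b\<close>. Knowing the nonzero set exactly gives both the support and the positivity at a
  prescribed point.\<close>

lemma smooth_real_bump:
  obtains f where "smooth_real f" and "\<And>x. 0 \<le> f x" and "\<And>x. f x \<noteq> 0 \<longleftrightarrow> a < x \<and> x < b"
proof
  have flat: "smooth_real (flat 0)"
    unfolding smooth_real_def by (rule exI[of _ flat]) (simp add: DERIV_flat)
  show "smooth_real (\<lambda>x. flat 0 (1 * x + - a) * flat 0 (- 1 * x + b))"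
    by (intro smooth_real_mult smooth_real_affine flat)
qed (auto simp: flat_def)

lemma smooth_field_product:
  assumes "smooth_real f" and "smooth_real g"
  shows "smooth_field (\<lambda>r t. f r * g t)"
proof -
  obtain F G where F: "F 0 = f" "\<And>k x. (F k has_real_derivative F (Suc k) x) (at x)"
    and G: "G 0 = g" "\<And>k x. (G k has_real_derivative G (Suc k) x) (at x)"
    using assms unfolding smooth_real_def by blast
  have "continuous_on UNIV (F k)" for k
    using F(2) by (intro continuous_at_imp_continuous_on ballI) (rule DERIV_isCont)
  moreover have "continuous_on UNIV (G k)" for k
    using G(2) by (intro continuous_at_imp_continuous_on ballI) (rule DERIV_isCont)
  ultimately have "continuous_on UNIV (\<lambda>(r, t). F i r * G j t)" for i j
    unfolding case_prod_unfold
    by (intro continuous_on_mult continuous_on_compose2[of UNIV "F i" UNIV fst]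
        continuous_on_compose2[of UNIV "G j" UNIV snd] continuous_on_fst continuous_on_snd
        continuous_on_id) auto
  then show ?thesis
    unfolding smooth_field_def
    by (intro exI[of _ "\<lambda>i j r t. F i r * G j t"])
      (simp add: F(1) G(1) DERIV_cmult DERIV_cmult_right F(2) G(2))
qed

lemma test_function_bump:
  assumes "open S" and "p \<in> S"
  obtains \<phi> where "test_function S \<phi>" and "\<And>r t. 0 \<le> \<phi> r t" and "\<phi> (fst p) (snd p) \<noteq> 0"
proof -
  obtain a b where ab: "p \<in> box a b" "cbox a b \<subseteq> S"
    using open_contains_cbox[OF assms] by metis
  obtain f where f: "smooth_real f" "\<And>x. 0 \<le> f x" "\<And>x. f x \<noteq> 0 \<longleftrightarrow> fst a < x \<and> x < fst b"
    by (rule smooth_real_bump[of "fst a" "fst b"]) blast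
  obtain g where g: "smooth_real g" "\<And>x. 0 \<le> g x" "\<And>x. g x \<noteq> 0 \<longleftrightarrow> snd a < x \<and> x < snd b"
    by (rule smooth_real_bump[of "snd a" "snd b"]) blast
  have p: "fst a < fst p" "fst p < fst b" "snd a < snd p" "snd p < snd b"
    using ab(1) by (auto simp: box_def Basis_prod_def inner_prod_def)
  have "f r * g t = 0" if "(r, t) \<notin> cbox a b" for r t
  proof -
    have "\<not> (fst a < r \<and> r < fst b) \<or> \<not> (snd a < t \<and> t < snd b)"
      using that by (auto simp: cbox_def Basis_prod_def inner_prod_def)
    then show ?thesis
      using f(3) g(3) by auto
  qed
  then have "test_function S (\<lambda>r t. f r * g t)"
    unfolding test_function_def using smooth_field_product[OF f(1) g(1)] ab(2)
    by (auto intro!: exI[of _ "cbox a b"])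
  then show thesis
    using that[of "\<lambda>r t. f r * g t"] f g p by auto
qed

subsection \<open>Continuously differentiable fields and the divergence theorem in a moving frame\<close>

text \<open>Naming the partial derivatives that \<open>C1_on\<close> only asserts to exist lets the
  product rule and the cutoff be followed by explicit formulas.\<close>

definition partials_on :: "(real \<times> real) set \<Rightarrow> field \<Rightarrow> field \<Rightarrow> field \<Rightarrow> bool" where
  "partials_on S f f\<^sub>r f\<^sub>t \<longleftrightarrow>
     (\<forall>(r, t)\<in>S. ((\<lambda>x. f x t) has_real_derivative f\<^sub>r r t) (at r) \<and>
                 ((\<lambda>s. f r s) has_real_derivative f\<^sub>t r t) (at t)) \<and>
     continuous_on S (\<lambda>(r, t). f\<^sub>r r t) \<and> continuous_on S (\<lambda>(r, t). f\<^sub>t r t)"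

lemma C1_on_iff_partials_on: "C1_on S f \<longleftrightarrow> (\<exists>f\<^sub>r f\<^sub>t. partials_on S f f\<^sub>r f\<^sub>t)"
  by (simp add: C1_on_def partials_on_def)

lemma partials_onD:
  assumes "partials_on S f f\<^sub>r f\<^sub>t" and "(r, t) \<in> S"
  shows "((\<lambda>x. f x t) has_real_derivative f\<^sub>r r t) (at r)"
    and "((\<lambda>s. f r s) has_real_derivative f\<^sub>t r t) (at t)"
  using assms by (auto simp: partials_on_def)

lemma partials_on_cong:
  assumes "partials_on S f f\<^sub>r f\<^sub>t"
    and "\<And>r t. f r t = g r t" "\<And>r t. f\<^sub>r r t = g\<^sub>r r t" "\<And>r t. f\<^sub>t r t = g\<^sub>t r t"
  shows "partials_on S g g\<^sub>r g\<^sub>t"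
  using assms by (metis ext)

text \<open>The total derivative is needed because the moving frame differentiates along the oblique
  lines r = R + v t + x. It follows from the partial ones by continuity of \<open>f\<^sub>t\<close>;
  the neighbourhood in t is a ball because the mean value argument behind this needs a convex
  set.\<close>

lemma partials_on_has_derivative:
  assumes "open S" and f: "partials_on S f f\<^sub>r f\<^sub>t" and "(r, t) \<in> S"
  shows "((\<lambda>(r, t). f r t) has_derivative (\<lambda>(h, k). f\<^sub>r r t * h + f\<^sub>t r t * k)) (at (r, t))"
proof -
  obtain A B where AB: "open A" "open B" "r \<in> A" "t \<in> B" "A \<times> B \<subseteq> S"
    using open_prod_elim[OF assms(1,3)] by (metis mem_Sigma_iff)
  obtain e where e: "e > 0" "ball t e \<subseteq> B"
    using AB(2,4) open_contains_ball by blast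
  have sub: "A \<times> ball t e \<subseteq> S"
    using AB(5) e(2) by blast
  have "continuous_on S (\<lambda>(x, y). f\<^sub>t x y)"
    using f by (simp add: partials_on_def)
  then have "continuous (at (r, t) within A \<times> ball t e) (\<lambda>(x, y). f\<^sub>t x y)"
    using assms(3) sub by (meson continuous_on_eq_continuous_within continuous_within_subset)
  then have cont: "continuous (at (r, t) within A \<times> ball t e) (\<lambda>(x, y). f\<^sub>t x y *\<^sub>R id_blinfun)"
    unfolding case_prod_unfold by (intro continuous_intros)
  have "((\<lambda>(r, t). f r t) has_derivative
      (\<lambda>(tx, ty). f\<^sub>r r t * tx + blinfun_apply (f\<^sub>t r t *\<^sub>R id_blinfun) ty)) (at (r, t) within A \<times> ball t e)"
  proof (rule has_derivative_partialsI[OF _ _ cont])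
    show "((\<lambda>x. f x t) has_derivative (\<lambda>h. f\<^sub>r r t * h)) (at r within A)"
      using partials_onD(1)[OF f assms(3)]
      by (simp add: has_field_derivative_def has_derivative_at_withinI)
    show "((\<lambda>y. f x y) has_derivative blinfun_apply (f\<^sub>t x y *\<^sub>R id_blinfun)) (at y within ball t e)"
      if "x \<in> A" "y \<in> ball t e" for x y
    proof -
      have "((\<lambda>y. f x y) has_derivative (\<lambda>h. f\<^sub>t x y * h)) (at y within ball t e)"
        unfolding has_field_derivative_def[symmetric]
        using partials_onD(2)[OF f, of x y] that sub by (blast intro: has_field_derivative_at_within)
      moreover have "blinfun_apply (f\<^sub>t x y *\<^sub>R id_blinfun) = (\<lambda>h. f\<^sub>t x y * h)"
        by (auto simp: blinfun.scaleR_left)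
      ultimately show ?thesis by simp
    qed
  qed (use e in auto)
  moreover have "at (r, t) within A \<times> ball t e = at (r, t)"
    using AB e by (intro at_within_open) (auto intro: open_Times)
  ultimately show ?thesis
    by (simp add: blinfun.scaleR_left)
qed

lemma partials_on_continuous:
  assumes "open S" and "partials_on S f f\<^sub>r f\<^sub>t"
  shows "continuous_on S (\<lambda>(r, t). f r t)"
proof (intro continuous_at_imp_continuous_on ballI)
  fix p assume "p \<in> S"
  then show "isCont (\<lambda>(r, t). f r t) p"
    using partials_on_has_derivative[OF assms, of "fst p" "snd p"] has_derivative_continuous by auto
qed

lemma partials_on_mult:
  assumes "open S" and f: "partials_on S f f\<^sub>r f\<^sub>t" and g: "partials_on S g g\<^sub>r g\<^sub>t"
  shows "partials_on S (\<lambda>r t. f r t * g r t)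
    (\<lambda>r t. f\<^sub>r r t * g r t + f r t * g\<^sub>r r t) (\<lambda>r t. f\<^sub>t r t * g r t + f r t * g\<^sub>t r t)"
  unfolding partials_on_def case_prod_unfold
proof (intro conjI ballI)
  fix p assume p: "p \<in> S"
  show "((\<lambda>x. f x (snd p) * g x (snd p)) has_real_derivative
      f\<^sub>r (fst p) (snd p) * g (fst p) (snd p) + f (fst p) (snd p) * g\<^sub>r (fst p) (snd p)) (at (fst p))"
    using p partials_onD(1)[OF f, of "fst p" "snd p"] partials_onD(1)[OF g, of "fst p" "snd p"]
    by (auto intro!: derivative_eq_intros)
  show "((\<lambda>s. f (fst p) s * g (fst p) s) has_real_derivative
      f\<^sub>t (fst p) (snd p) * g (fst p) (snd p) + f (fst p) (snd p) * g\<^sub>t (fst p) (snd p)) (at (snd p))"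
    using p partials_onD(2)[OF f, of "fst p" "snd p"] partials_onD(2)[OF g, of "fst p" "snd p"]
    by (auto intro!: derivative_eq_intros)
next
  note c = partials_on_continuous[OF assms(1) f] partials_on_continuous[OF assms(1) g]
    f[unfolded partials_on_def] g[unfolded partials_on_def]
  show "continuous_on S (\<lambda>p. f\<^sub>r (fst p) (snd p) * g (fst p) (snd p) + f (fst p) (snd p) * g\<^sub>r (fst p) (snd p))"
    and "continuous_on S (\<lambda>p. f\<^sub>t (fst p) (snd p) * g (fst p) (snd p) + f (fst p) (snd p) * g\<^sub>t (fst p) (snd p))"
    using c unfolding case_prod_unfold by (auto intro!: continuous_on_add continuous_on_mult)
qed

lemma partials_on_subset: "partials_on S f f\<^sub>r f\<^sub>t \<Longrightarrow> T \<subseteq> S \<Longrightarrow> partials_on T f f\<^sub>r f\<^sub>t"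
  unfolding partials_on_def by (blast intro: continuous_on_subset)

text \<open>\<open>S\<close> is covered by two relatively open pieces: the one inside
  \<open>U\<close>, where both factors are continuous, and the one off \<open>K\<close>, where the
  product is zero. Thus \<open>g\<close> may take arbitrary values outside \<open>U\<close>.\<close>

lemma continuous_on_cutoff:
  fixes g \<phi> :: "'a::topological_space \<Rightarrow> real"
  assumes "continuous_on (S \<inter> U) g" and "continuous_on S \<phi>"
    and "open U" "closed K" "K \<subseteq> U" and zero: "\<And>p. p \<notin> K \<Longrightarrow> \<phi> p = 0"
  shows "continuous_on S (\<lambda>p. g p * \<phi> p)"
proof -
  have "continuous_on (S \<inter> U) (\<lambda>p. g p * \<phi> p)"
    by (intro continuous_on_mult assms(1) continuous_on_subset[OF assms(2)]) auto
  moreover have "continuous_on (S \<inter> - K) (\<lambda>p. g p * \<phi> p)"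
    by (rule continuous_on_eq[of _ "\<lambda>_. 0"]) (auto simp: zero)
  moreover have "openin (top_of_set S) (S \<inter> U)" "openin (top_of_set S) (S \<inter> - K)"
    using assms(3,4) by (auto intro: openin_open_Int)
  ultimately have "continuous_on ((S \<inter> U) \<union> (S \<inter> - K)) (\<lambda>p. g p * \<phi> p)"
    by (intro continuous_on_Un_local_open) (auto intro: openin_subset_trans)
  moreover have "(S \<inter> U) \<union> (S \<inter> - K) = S"
    using assms(5) by auto
  ultimately show ?thesis by simp
qed

text \<open>Off the closed set \<open>K\<close> the product vanishes in a whole neighbourhood, so
  its derivatives are zero there whatever \<open>f\<close> does. A field that is regular only inside
  the domain thereby becomes regular on all of \<open>W\<close>.\<close>

lemma partials_on_cutoff:
  assumes f: "partials_on (W \<inter> U) f f\<^sub>r f\<^sub>t" and \<phi>: "partials_on UNIV \<phi> \<phi>\<^sub>r \<phi>\<^sub>t"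
    and "open W" "open U" "closed K" "K \<subseteq> U"
    and zero: "\<And>r t. (r, t) \<notin> K \<Longrightarrow> \<phi> r t = 0 \<and> \<phi>\<^sub>r r t = 0 \<and> \<phi>\<^sub>t r t = 0"
  shows "partials_on W (\<lambda>r t. f r t * \<phi> r t)
    (\<lambda>r t. f\<^sub>r r t * \<phi> r t + f r t * \<phi>\<^sub>r r t) (\<lambda>r t. f\<^sub>t r t * \<phi> r t + f r t * \<phi>\<^sub>t r t)"
proof -
  have m: "partials_on (W \<inter> U) (\<lambda>r t. f r t * \<phi> r t)
    (\<lambda>r t. f\<^sub>r r t * \<phi> r t + f r t * \<phi>\<^sub>r r t) (\<lambda>r t. f\<^sub>t r t * \<phi> r t + f r t * \<phi>\<^sub>t r t)"
    using assms by (intro partials_on_mult partials_on_subset[OF \<phi>]) auto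
  have d: "((\<lambda>x. f x t * \<phi> x t) has_real_derivative f\<^sub>r r t * \<phi> r t + f r t * \<phi>\<^sub>r r t) (at r) \<and>
      ((\<lambda>s. f r s * \<phi> r s) has_real_derivative f\<^sub>t r t * \<phi> r t + f r t * \<phi>\<^sub>t r t) (at t)"
    if "(r, t) \<in> W" for r t
  proof (cases "(r, t) \<in> K")
    case True
    then show ?thesis using partials_onD[OF m] that assms(6) by blast
  next
    case False
    have o: "open ((\<lambda>x. (x, t)) -` (- K))" "open ((\<lambda>s. (r, s)) -` (- K))"
      using assms(5) by (auto intro!: open_vimage continuous_intros)
    have "((\<lambda>x. f x t * \<phi> x t) has_real_derivative 0) (at r)"
      by (rule has_field_derivative_transform_within_open[OF DERIV_const[of 0] o(1)])
        (use False zero in auto)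
    moreover have "((\<lambda>s. f r s * \<phi> r s) has_real_derivative 0) (at t)"
      by (rule has_field_derivative_transform_within_open[OF DERIV_const[of 0] o(2)])
        (use False zero in auto)
    ultimately show ?thesis using zero[OF False] by simp
  qed
  have cont: "continuous_on W (\<lambda>p. g (fst p) (snd p) * \<psi> (fst p) (snd p))"
    if "continuous_on (W \<inter> U) (\<lambda>(r, t). g r t)" "continuous_on UNIV (\<lambda>(r, t). \<psi> r t)"
      "\<And>r t. (r, t) \<notin> K \<Longrightarrow> \<psi> r t = 0" for g \<psi> :: field
    by (rule continuous_on_cutoff[OF that(1)[unfolded case_prod_unfold]
          continuous_on_subset[OF that(2)[unfolded case_prod_unfold]] assms(4-6)])
      (use that(3) in \<open>auto simp: prod_eq_iff\<close>)
  have f': "continuous_on (W \<inter> U) (\<lambda>(r, t). f r t)"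
    using partials_on_continuous[OF _ f] assms(3,4) by auto
  have \<phi>': "continuous_on UNIV (\<lambda>(r, t). \<phi> r t)"
    using partials_on_continuous[OF _ \<phi>] by auto
  have c: "continuous_on (W \<inter> U) (\<lambda>(r, t). f\<^sub>r r t)" "continuous_on (W \<inter> U) (\<lambda>(r, t). f\<^sub>t r t)"
    "continuous_on UNIV (\<lambda>(r, t). \<phi>\<^sub>r r t)" "continuous_on UNIV (\<lambda>(r, t). \<phi>\<^sub>t r t)"
    using f \<phi> by (simp_all add: partials_on_def)
  have "continuous_on W (\<lambda>p. f\<^sub>r (fst p) (snd p) * \<phi> (fst p) (snd p) + f (fst p) (snd p) * \<phi>\<^sub>r (fst p) (snd p))"
    and "continuous_on W (\<lambda>p. f\<^sub>t (fst p) (snd p) * \<phi> (fst p) (snd p) + f (fst p) (snd p) * \<phi>\<^sub>t (fst p) (snd p))"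
    by (intro continuous_on_add cont f' \<phi>' c; simp add: zero)+
  then show ?thesis
    unfolding partials_on_def case_prod_unfold
  proof (intro conjI)
  qed (use d in auto)
qed

lemma has_real_derivative_along_line:
  assumes "open S" and "partials_on S f f\<^sub>r f\<^sub>t" and "(R + v * t + x, t) \<in> S"
  shows "((\<lambda>s. f (R + v * s + x) s) has_real_derivative
      v * f\<^sub>r (R + v * t + x) t + f\<^sub>t (R + v * t + x) t) (at t)"
proof -
  have "((\<lambda>s. (R + v * s + x, s)) has_derivative (\<lambda>h. (v * h, h))) (at t)"
    by (auto intro!: derivative_eq_intros)
  from has_derivative_compose[OF this partials_on_has_derivative[OF assms]]
  have "((\<lambda>s. f (R + v * s + x) s) has_derivative
      (\<lambda>h. f\<^sub>r (R + v * t + x) t * (v * h) + f\<^sub>t (R + v * t + x) t * h)) (at t)"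
    by simp
  then   show ?thesis
    unfolding has_field_derivative_def by (rule has_derivative_eq_rhs) (auto simp: algebra_simps)
qed

text \<open>In the coordinate x = r - R - v t the region is a box, and P_t + Q_r = (v P_r + P_t) +
  (Q_r - v P_r). The first bracket is the derivative of \<open>P\<close> along lines of constant x
  and integrates to zero in t, since \<open>P\<close> vanishes at both end times; the second is the
  x-derivative of Q - v P and leaves the two edges.\<close>

lemma moving_frame_divergence:
  assumes "open W" and P: "partials_on W P P\<^sub>r P\<^sub>t" and Q: "partials_on W Q Q\<^sub>r Q\<^sub>t"
    and "a \<le> b" "c \<le> d"
    and W: "\<And>x t. a \<le> x \<Longrightarrow> x \<le> b \<Longrightarrow> (R + v * t + x, t) \<in> W"
    and zero: "\<And>x. P (R + v * c + x) c = 0" "\<And>x. P (R + v * d + x) d = 0"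
  shows "integral (cbox (a, c) (b, d)) (\<lambda>(x, t). P\<^sub>t (R + v * t + x) t + Q\<^sub>r (R + v * t + x) t) =
    integral {c..d} (\<lambda>t. Q (R + v * t + b) t - v * P (R + v * t + b) t) -
    integral {c..d} (\<lambda>t. Q (R + v * t + a) t - v * P (R + v * t + a) t)"
proof -
  let ?B = "cbox (a, c) (b, d)"
  have B: "(x, t) \<in> ?B \<longleftrightarrow> a \<le> x \<and> x \<le> b \<and> c \<le> t \<and> t \<le> d" for x t
    by (auto simp: cbox_Pair_eq)
  have frame: "continuous_on ?B (\<lambda>(x, t). f (R + v * t + x) t)"
    if "continuous_on W (\<lambda>(r, t). f r t)" for f :: field
    unfolding case_prod_unfold
    by (rule continuous_on_compose2[OF that[unfolded case_prod_unfold],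
          of _ "\<lambda>p. (R + v * snd p + fst p, snd p)", simplified])
      (auto intro!: continuous_intros W simp: B)
  have line: "continuous_on {c..d} (\<lambda>t. f (R + v * t + x) t)"
    if "continuous_on W (\<lambda>(r, t). f r t)" "a \<le> x" "x \<le> b" for f :: field and x
    by (rule continuous_on_compose2[OF that(1)[unfolded case_prod_unfold],
          of _ "\<lambda>t. (R + v * t + x, t)", simplified])
      (auto intro!: continuous_intros W that)
  have cP: "continuous_on W (\<lambda>(r, t). P\<^sub>r r t)" "continuous_on W (\<lambda>(r, t). P\<^sub>t r t)"
    and cQ: "continuous_on W (\<lambda>(r, t). Q\<^sub>r r t)"
    using P Q by (auto simp: partials_on_def)
  have "continuous_on ?B (\<lambda>(x, t). v * P\<^sub>r (R + v * t + x) t + P\<^sub>t (R + v * t + x) t)"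
    using frame[OF cP(1)] frame[OF cP(2)] unfolding case_prod_unfold
    by (intro continuous_intros)
  note along = this
  have "continuous_on ?B (\<lambda>(x, t). Q\<^sub>r (R + v * t + x) t - v * P\<^sub>r (R + v * t + x) t)"
    using frame[OF cP(1)] frame[OF cQ] unfolding case_prod_unfold
    by (intro continuous_intros)
  note across = this
  have "integral {c..d} (\<lambda>t. v * P\<^sub>r (R + v * t + x) t + P\<^sub>t (R + v * t + x) t) = 0"
    if "x \<in> {a..b}" for x
  proof (rule integral_unique)
    have "((\<lambda>t. v * P\<^sub>r (R + v * t + x) t + P\<^sub>t (R + v * t + x) t) has_integral
        P (R + v * d + x) d - P (R + v * c + x) c) {c..d}"
    proof (rule fundamental_theorem_of_calculus[OF \<open>c \<le> d\<close>])
      fix t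
      have "(R + v * t + x, t) \<in> W"
        using W that by simp
      from has_real_derivative_along_line[OF assms(1) P this]
      show "((\<lambda>t. P (R + v * t + x) t) has_vector_derivative
          v * P\<^sub>r (R + v * t + x) t + P\<^sub>t (R + v * t + x) t) (at t within {c..d})"
        by (simp add: has_field_derivative_at_within flip: has_real_derivative_iff_has_vector_derivative)
    qed
    then show "((\<lambda>t. v * P\<^sub>r (R + v * t + x) t + P\<^sub>t (R + v * t + x) t) has_integral 0) {c..d}"
      by (simp add: zero)
  qed
  then have "integral {a..b} (\<lambda>x. integral {c..d}
      (\<lambda>t. v * P\<^sub>r (R + v * t + x) t + P\<^sub>t (R + v * t + x) t)) = integral {a..b} (\<lambda>_. 0)"
    by (rule integral_cong)
  then have "integral ?B (\<lambda>(x, t). v * P\<^sub>r (R + v * t + x) t + P\<^sub>t (R + v * t + x) t) = 0"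
    using integral_prod_continuous[OF along] by simp
  moreover have "integral {a..b} (\<lambda>x. Q\<^sub>r (R + v * t + x) t - v * P\<^sub>r (R + v * t + x) t) =
      (Q (R + v * t + b) t - v * P (R + v * t + b) t) - (Q (R + v * t + a) t - v * P (R + v * t + a) t)"
    for t
  proof (rule integral_unique, rule fundamental_theorem_of_calculus[OF \<open>a \<le> b\<close>])
    fix x assume x: "x \<in> {a..b}"
    have shift: "((\<lambda>x. f (R + v * t + x) t) has_real_derivative f\<^sub>r (R + v * t + x) t) (at x)"
      if "partials_on W f f\<^sub>r f\<^sub>t" for f f\<^sub>r f\<^sub>t
    proof -
      have "((\<lambda>x. f x t) has_real_derivative f\<^sub>r (R + v * t + x) t) (at (R + v * t + x))"
        using partials_onD(1)[OF that W] x by auto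
      moreover have "((\<lambda>x. R + v * t + x) has_real_derivative 1) (at x)"
        by (auto intro!: derivative_eq_intros)
      ultimately have "((\<lambda>x. f (R + v * t + x) t) has_real_derivative f\<^sub>r (R + v * t + x) t * 1) (at x)"
        by (rule DERIV_chain2)
      then show ?thesis by simp
    qed
    have "((\<lambda>x. Q (R + v * t + x) t - v * P (R + v * t + x) t) has_real_derivative
        Q\<^sub>r (R + v * t + x) t - v * P\<^sub>r (R + v * t + x) t) (at x)"
      by (intro derivative_intros shift[OF P] shift[OF Q] DERIV_cmult)
    then show "((\<lambda>x. Q (R + v * t + x) t - v * P (R + v * t + x) t) has_vector_derivative
        Q\<^sub>r (R + v * t + x) t - v * P\<^sub>r (R + v * t + x) t) (at x within {a..b})"
      by (simp flip: has_real_derivative_iff_has_vector_derivative add: has_field_derivative_at_within)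
  qed
  then have swap: "integral ?B (\<lambda>(x, t). Q\<^sub>r (R + v * t + x) t - v * P\<^sub>r (R + v * t + x) t) =
      integral {c..d} (\<lambda>t. (Q (R + v * t + b) t - v * P (R + v * t + b) t)
        - (Q (R + v * t + a) t - v * P (R + v * t + a) t))"
    using integral_prod_continuous[OF across] integral_swap_continuous[OF across] by simp
  have split: "integral {c..d} (\<lambda>t. (Q (R + v * t + b) t - v * P (R + v * t + b) t)
        - (Q (R + v * t + a) t - v * P (R + v * t + a) t)) = integral {c..d} (\<lambda>t. Q (R + v * t + b) t - v * P (R + v * t + b) t) -
      integral {c..d} (\<lambda>t. Q (R + v * t + a) t - v * P (R + v * t + a) t)"
    using \<open>a \<le> b\<close> line[OF partials_on_continuous[OF assms(1) P], of a]
      line[OF partials_on_continuous[OF assms(1) P], of b]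
      line[OF partials_on_continuous[OF assms(1) Q], of a]
      line[OF partials_on_continuous[OF assms(1) Q], of b]
    by (intro Henstock_Kurzweil_Integration.integral_diff integrable_continuous_real
        continuous_on_diff continuous_on_mult continuous_on_const) simp_all
  moreover have "integral ?B (\<lambda>(x, t). P\<^sub>t (R + v * t + x) t + Q\<^sub>r (R + v * t + x) t) =
      integral ?B (\<lambda>(x, t). v * P\<^sub>r (R + v * t + x) t + P\<^sub>t (R + v * t + x) t) +
      integral ?B (\<lambda>(x, t). Q\<^sub>r (R + v * t + x) t - v * P\<^sub>r (R + v * t + x) t)"
    using Henstock_Kurzweil_Integration.integral_add[OF integrable_continuous[OF along]
        integrable_continuous[OF across]]
    by (simp add: case_prod_unfold)
  ultimately show ?thesis using swap split by simp
qed

subsection \<open>Integration over strips along the front\<close>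

text \<open>For fixed t the shear is a translation in r, so it preserves measure by Tonelli with the
  r-integral innermost.\<close>

lemma distr_lborel_shear:
  "distr lborel borel (\<lambda>(r, t). (r - R - v * t, t)) = (lborel :: (real \<times> real) measure)"
proof (rule measure_eqI)
  let ?T = "\<lambda>(r, t). (r - R - v * t, t) :: real \<times> real"
  have T: "?T \<in> borel_measurable borel"
    unfolding case_prod_unfold by (intro borel_measurable_continuous_onI continuous_intros)
  fix A :: "(real \<times> real) set" assume "A \<in> sets (distr lborel borel ?T)"
  then have A[measurable]: "A \<in> sets borel" by simp
  have A': "indicator A \<in> borel_measurable (lborel \<Otimes>\<^sub>M lborel)"
    by (simp add: lborel_prod)
  have TA: "?T -` A \<in> sets borel"
    using measurable_sets[OF T A] by simp
  then have TA': "indicator (?T -` A) \<in> borel_measurable (lborel \<Otimes>\<^sub>M lborel)"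
    by (simp add: lborel_prod)
  have "emeasure (distr lborel borel ?T) A = emeasure lborel (?T -` A)"
    using T by (simp add: emeasure_distr)
  also have "\<dots> = (\<integral>\<^sup>+ p. indicator (?T -` A) p \<partial>(lborel \<Otimes>\<^sub>M lborel))"
    using TA by (simp add: lborel_prod)
  also have "\<dots> = (\<integral>\<^sup>+ t. \<integral>\<^sup>+ r. indicator (?T -` A) (r, t) \<partial>lborel \<partial>lborel)"
    by (rule lborel_pair.nn_integral_snd[OF TA', symmetric])
  also have "\<dots> = (\<integral>\<^sup>+ t. \<integral>\<^sup>+ r. indicator A (r, t) \<partial>lborel \<partial>lborel)"
  proof (rule nn_integral_cong)
    fix t :: real
    have "(\<lambda>r. indicator A (r, t) :: ennreal) \<in> borel_measurable borel"
      by measurable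
    from nn_integral_real_affine[OF this, of 1 "- R - v * t"]
    show "(\<integral>\<^sup>+ r. indicator (?T -` A) (r, t) \<partial>lborel) = (\<integral>\<^sup>+ r. indicator A (r, t) \<partial>lborel)"
      by (simp add: indicator_def algebra_simps)
  qed
  also have "\<dots> = (\<integral>\<^sup>+ p. indicator A p \<partial>(lborel \<Otimes>\<^sub>M lborel))"
    by (rule lborel_pair.nn_integral_snd[OF A'])
  also have "\<dots> = emeasure lborel A"
    by (simp add: lborel_prod)
  finally show "emeasure (distr lborel borel ?T) A = emeasure lborel A" .
qed simp

lemma integral_lborel_shear:
  fixes h :: "real \<times> real \<Rightarrow> real"
  assumes "h \<in> borel_measurable borel"
  shows "(LINT p|lborel. (case p of (r, t) \<Rightarrow> h (r - R - v * t, t))) = integral\<^sup>L lborel h"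
proof -
  have T: "(\<lambda>(r, t). (r - R - v * t, t) :: real \<times> real) \<in> borel_measurable borel"
    unfolding case_prod_unfold by (intro borel_measurable_continuous_onI continuous_intros)
  show ?thesis
    using integral_distr[of "\<lambda>(r, t). (r - R - v * t, t)" lborel borel h] T assms
    by (simp add: distr_lborel_shear[unfolded case_prod_unfold] case_prod_unfold)
qed

lemma AE_lborel_fst_neq: "AE p in (lborel :: (real \<times> real) measure). fst p \<noteq> a"
proof (rule AE_I')
  have "emeasure (lborel \<Otimes>\<^sub>M lborel) ({a} \<times> (UNIV :: real set)) = 0"
    by (subst lborel.emeasure_pair_measure_Times) auto
  moreover have "closed ({a} \<times> (UNIV :: real set))"
    by (intro closed_Times) auto
  ultimately show "{a} \<times> UNIV \<in> null_sets (lborel :: (real \<times> real) measure)"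
    by (auto simp: null_sets_def lborel_prod)
qed auto

text \<open>Passes from the Lebesgue integral of the weak form to a Henstock-Kurzweil integral over
  a closed box, to which the divergence theorem applies. The two integrands may disagree on the null
  lines \<open>x = a\<close> and \<open>x = b\<close>, which takes care of half-open strips.\<close>

lemma integral_indicator_strip:
  fixes g :: "real \<times> real \<Rightarrow> real"
  assumes g: "continuous_on (cbox (a, c) (b, d)) g"
    and meas: "(\<lambda>p. indicator A p *\<^sub>R g p) \<in> borel_measurable borel"
    and eq: "\<And>x t. x \<noteq> a \<Longrightarrow> x \<noteq> b \<Longrightarrow>
      indicator A (x, t) *\<^sub>R g (x, t) = indicator (cbox (a, c) (b, d)) (x, t) *\<^sub>R g (x, t)"
  shows "has_bochner_integral lborel (\<lambda>p. indicator A p *\<^sub>R g p) (integral (cbox (a, c) (b, d)) g)"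
proof -
  have int: "set_integrable lborel (cbox (a, c) (b, d)) g"
    unfolding set_integrable_def by (rule borel_integrable_compact[OF compact_cbox g])
  have "AE p in lborel. indicator (cbox (a, c) (b, d)) p *\<^sub>R g p = indicator A p *\<^sub>R g p"
    using AE_lborel_fst_neq[of a] AE_lborel_fst_neq[of b] by eventually_elim (metis eq prod.collapse)
  moreover have "has_bochner_integral lborel (\<lambda>p. indicator (cbox (a, c) (b, d)) p *\<^sub>R g p)
      (integral (cbox (a, c) (b, d)) g)"
    using int set_borel_integral_eq_integral(2)[OF int]
    unfolding set_integrable_def set_lebesgue_integral_def
    by (simp add: has_bochner_integral_iff)
  moreover have "(\<lambda>p. indicator (cbox (a, c) (b, d)) p *\<^sub>R g p) \<in> borel_measurable lborel"
    using int unfolding set_integrable_def by (rule borel_measurable_integrable)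
  ultimately show ?thesis
    using meas by (subst has_bochner_integral_cong_AE[symmetric]) auto
qed

text \<open>The outer integrands have to be continuous only at distance at least \<delta> from the
  front, because their derivatives may be singular at x = 0. The box of size \<open>N\<close> stands
  for the support of the test function.\<close>

lemma integral_three_strips:
  fixes g\<^sub>0 g\<^sub>m g\<^sub>1 :: "real \<times> real \<Rightarrow> real"
  defines "h \<equiv> \<lambda>\<delta> p. if fst p < - \<delta> then g\<^sub>0 p else if fst p < \<delta> then g\<^sub>m p else g\<^sub>1 p"
  assumes "0 < \<delta>" "\<delta> < N"
    and g\<^sub>0: "continuous_on {p. fst p \<le> - \<delta>} g\<^sub>0" and g\<^sub>m: "continuous_on UNIV g\<^sub>m"
    and g\<^sub>1: "continuous_on {p. \<delta> \<le> fst p} g\<^sub>1"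
    and zero: "\<And>p. p \<notin> cbox (- N, - N) (N, N) \<Longrightarrow> g\<^sub>0 p = 0 \<and> g\<^sub>m p = 0 \<and> g\<^sub>1 p = 0"
  shows "h \<delta> \<in> borel_measurable borel"
    and "integral\<^sup>L lborel (h \<delta>) = integral (cbox (- N, - N) (- \<delta>, N)) g\<^sub>0
      + integral (cbox (- \<delta>, - N) (\<delta>, N)) g\<^sub>m + integral (cbox (\<delta>, - N) (N, N)) g\<^sub>1"
proof -
  let ?L = "{p. fst p < - \<delta>} :: (real \<times> real) set" and ?M = "{p. - \<delta> \<le> fst p \<and> fst p < \<delta>} :: (real \<times> real) set"
    and ?R = "{p. \<delta> \<le> fst p} :: (real \<times> real) set"
  have h: "h \<delta> = (\<lambda>p. indicator ?L p *\<^sub>R g\<^sub>0 p + indicator ?M p *\<^sub>R g\<^sub>m p + indicator ?R p *\<^sub>R g\<^sub>1 p)"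
    using \<open>0 < \<delta>\<close> by (auto simp: h_def fun_eq_iff)
  have "open ?L" "closed ?R" "open {p :: real \<times> real. fst p < \<delta>}" "closed {p :: real \<times> real. - \<delta> \<le> fst p}"
    by (auto intro!: open_Collect_less closed_Collect_le continuous_intros)
  then have sets: "?L \<in> sets borel" "?R \<in> sets borel"
    "{p. - \<delta> \<le> fst p} \<inter> {p. fst p < \<delta>} \<in> sets (borel :: (real \<times> real) measure)"
    by (auto simp del: Collect_conj_eq)
  have M: "?M = {p. - \<delta> \<le> fst p} \<inter> {p. fst p < \<delta>}"
    by auto
  have meas: "(\<lambda>p. indicator ?L p *\<^sub>R g\<^sub>0 p) \<in> borel_measurable borel"
    "(\<lambda>p. indicator ?M p *\<^sub>R g\<^sub>m p) \<in> borel_measurable borel"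
    "(\<lambda>p. indicator ?R p *\<^sub>R g\<^sub>1 p) \<in> borel_measurable borel"
    using sets unfolding M
    by (intro borel_measurable_continuous_on_indicator continuous_on_subset[OF g\<^sub>0]
        continuous_on_subset[OF g\<^sub>m] continuous_on_subset[OF g\<^sub>1]; auto)+
  show "h \<delta> \<in> borel_measurable borel"
    unfolding h by (intro borel_measurable_add meas)
  have zero': "g\<^sub>0 (x, t) = 0" "g\<^sub>m (x, t) = 0" "g\<^sub>1 (x, t) = 0"
    if "\<not> (- N \<le> x \<and> x \<le> N \<and> - N \<le> t \<and> t \<le> N)" for x t
    using zero[of "(x, t)"] that by (auto simp: cbox_Pair_eq)
  have "has_bochner_integral lborel (\<lambda>p. indicator ?L p *\<^sub>R g\<^sub>0 p) (integral (cbox (- N, - N) (- \<delta>, N)) g\<^sub>0)"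
    using zero' \<open>0 < \<delta>\<close> \<open>\<delta> < N\<close>
    by (intro integral_indicator_strip continuous_on_subset[OF g\<^sub>0] meas)
      (auto simp: cbox_Pair_eq indicator_def)
  moreover have "has_bochner_integral lborel (\<lambda>p. indicator ?M p *\<^sub>R g\<^sub>m p) (integral (cbox (- \<delta>, - N) (\<delta>, N)) g\<^sub>m)"
    using zero' \<open>0 < \<delta>\<close> \<open>\<delta> < N\<close>
    by (intro integral_indicator_strip continuous_on_subset[OF g\<^sub>m] meas)
      (auto simp: cbox_Pair_eq indicator_def)
  moreover have "has_bochner_integral lborel (\<lambda>p. indicator ?R p *\<^sub>R g\<^sub>1 p) (integral (cbox (\<delta>, - N) (N, N)) g\<^sub>1)"
    using zero' \<open>0 < \<delta>\<close> \<open>\<delta> < N\<close>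
    by (intro integral_indicator_strip continuous_on_subset[OF g\<^sub>1] meas)
      (auto simp: cbox_Pair_eq indicator_def)
  ultimately show "integral\<^sup>L lborel (h \<delta>) = integral (cbox (- N, - N) (- \<delta>, N)) g\<^sub>0
      + integral (cbox (- \<delta>, - N) (\<delta>, N)) g\<^sub>m + integral (cbox (\<delta>, - N) (N, N)) g\<^sub>1"
    unfolding h by (intro has_bochner_integral_integral_eq has_bochner_integral_add)
qed

text \<open>The mean is a symmetric difference quotient of an antiderivative of \<open>f\<close>,
  and each of its two halves contributes \<open>f 0 / 2\<close>.\<close>

lemma tendsto_symmetric_mean:
  fixes f :: "real \<Rightarrow> real"
  assumes f: "continuous_on UNIV f"
  shows "((\<lambda>\<epsilon>. integral {- (\<epsilon> / 2)..\<epsilon> / 2} f / \<epsilon>) \<longlongrightarrow> f 0) (at_right 0)"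
proof -
  \<comment> \<open>The base point \<open>- 1\<close> lies to the left of every window with
    \<epsilon> < 1.\<close>
  define F where "F x = integral {- 1..x} f" for x
  have F: "(F has_real_derivative f 0) (at 0)"
  proof -
    have "((\<lambda>x. integral {- 1..x} f) has_vector_derivative f 0) (at 0 within {- 1..1})"
      using continuous_on_subset[OF f] by (intro integral_has_vector_derivative) auto
    moreover have "at (0::real) within {- 1..1} = at 0"
      by (rule at_within_interior) auto
    ultimately show ?thesis
      by (simp add: F_def[abs_def] has_real_derivative_iff_has_vector_derivative)
  qed
  have half: "((\<lambda>\<epsilon>. F (c * \<epsilon>)) has_real_derivative f 0 * c) (at 0)" for c
  proof -
    have "((\<lambda>\<epsilon>. c * \<epsilon>) has_real_derivative c) (at 0)"
      by (auto intro!: derivative_eq_intros)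
    then show ?thesis
      using F by (intro DERIV_chain2[where f = F and g = "\<lambda>\<epsilon>. c * \<epsilon>"]) auto
  qed
  have "((\<lambda>\<epsilon>. F (1 / 2 * \<epsilon>) - F (- 1 / 2 * \<epsilon>)) has_real_derivative f 0 * (1 / 2) - f 0 * (- 1 / 2)) (at 0)"
    by (rule DERIV_diff[OF half half])
  then have "((\<lambda>\<epsilon>. (F (\<epsilon> / 2) - F (- (\<epsilon> / 2))) / \<epsilon>) \<longlongrightarrow> f 0) (at 0)"
    by (simp add: DERIV_def)
  then have "((\<lambda>\<epsilon>. (F (\<epsilon> / 2) - F (- (\<epsilon> / 2))) / \<epsilon>) \<longlongrightarrow> f 0) (at_right 0)"
    by (simp add: filterlim_split_at_real filterlim_at_split)
  moreover have "\<forall>\<^sub>F \<epsilon> in at_right 0. (F (\<epsilon> / 2) - F (- (\<epsilon> / 2))) / \<epsilon> = integral {- (\<epsilon> / 2)..\<epsilon> / 2} f / \<epsilon>"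
    unfolding eventually_at_right_field
  proof (intro exI[of _ 1] conjI allI impI)
    fix \<epsilon> :: real assume "\<epsilon> > 0" "\<epsilon> < 1"
    then have "integral {- 1..- (\<epsilon> / 2)} f + integral {- (\<epsilon> / 2)..\<epsilon> / 2} f = integral {- 1..\<epsilon> / 2} f"
      by (intro Henstock_Kurzweil_Integration.integral_combine integrable_continuous_real
          continuous_on_subset[OF f]) auto
    then show "(F (\<epsilon> / 2) - F (- (\<epsilon> / 2))) / \<epsilon> = integral {- (\<epsilon> / 2)..\<epsilon> / 2} f / \<epsilon>"
      by (simp add: F_def)
  qed simp
  ultimately show ?thesis
    by (rule Lim_transform_eventually)
qed

subsection \<open>Energy balance of classical solutions\<close>

text \<open>The energy law is u times the momentum equation minus u^2 / 2 times the mass equation.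
  It therefore holds exactly wherever the solution is classical, and only the front can produce or
  dissipate energy.\<close>

lemma energy_balance:
  assumes "open S" and sol: "classical_solution n S \<rho> u"
  obtains E\<^sub>r E\<^sub>t F\<^sub>r F\<^sub>t where
    "partials_on S (\<lambda>r t. 1 / 2 * \<rho> r t * (u r t)\<^sup>2) E\<^sub>r E\<^sub>t"
    and "partials_on S (\<lambda>r t. 1 / 2 * \<rho> r t * (u r t)^3) F\<^sub>r F\<^sub>t"
    and "\<And>r t. (r, t) \<in> S \<Longrightarrow> E\<^sub>t r t + F\<^sub>r r t + (real n - 1) / (2 * r) * \<rho> r t * (u r t)^3 = 0"
proof -
  obtain \<rho>\<^sub>r \<rho>\<^sub>t u\<^sub>r u\<^sub>t where \<rho>: "partials_on S \<rho> \<rho>\<^sub>r \<rho>\<^sub>t" and u: "partials_on S u u\<^sub>r u\<^sub>t"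
    using sol by (auto simp: classical_solution_def C1_on_iff_partials_on)
  have half: "partials_on S (\<lambda>r t. 1 / 2) (\<lambda>r t. 0) (\<lambda>r t. 0)"
    by (auto simp: partials_on_def case_prod_unfold)
  note \<rho>u = partials_on_mult[OF assms(1) partials_on_mult[OF assms(1) half \<rho>] u]
  note \<rho>uu = partials_on_mult[OF assms(1) \<rho>u u]
  note \<rho>uuu = partials_on_mult[OF assms(1) \<rho>uu u]
  have E: "partials_on S (\<lambda>r t. 1 / 2 * \<rho> r t * (u r t)\<^sup>2)
      (\<lambda>r t. \<rho>\<^sub>r r t * (u r t)\<^sup>2 / 2 + \<rho> r t * u r t * u\<^sub>r r t)
      (\<lambda>r t. \<rho>\<^sub>t r t * (u r t)\<^sup>2 / 2 + \<rho> r t * u r t * u\<^sub>t r t)"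
    by (rule partials_on_cong[OF \<rho>uu]) (simp_all add: power2_eq_square field_simps)
  have F: "partials_on S (\<lambda>r t. 1 / 2 * \<rho> r t * (u r t)^3)
      (\<lambda>r t. \<rho>\<^sub>r r t * (u r t)^3 / 2 + 3 * \<rho> r t * (u r t)\<^sup>2 * u\<^sub>r r t / 2)
      (\<lambda>r t. \<rho>\<^sub>t r t * (u r t)^3 / 2 + 3 * \<rho> r t * (u r t)\<^sup>2 * u\<^sub>t r t / 2)"
    by (rule partials_on_cong[OF \<rho>uuu]) (simp_all add: power2_eq_square power3_eq_cube field_simps)
  show thesis
  proof (rule that[OF E F])
    fix r t assume rt: "(r, t) \<in> S"
    note d = partials_onD[OF \<rho> rt] partials_onD[OF u rt]
    have "deriv (\<lambda>s. \<rho> r s) t = \<rho>\<^sub>t r t"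
      and "deriv (\<lambda>x. \<rho> x t * u x t) r = \<rho>\<^sub>r r t * u r t + \<rho> r t * u\<^sub>r r t"
      and "deriv (\<lambda>s. \<rho> r s * u r s) t = \<rho>\<^sub>t r t * u r t + \<rho> r t * u\<^sub>t r t"
      and "deriv (\<lambda>x. \<rho> x t * (u x t)\<^sup>2) r = \<rho>\<^sub>r r t * (u r t)\<^sup>2 + 2 * \<rho> r t * u r t * u\<^sub>r r t"
      using d by (auto intro!: DERIV_imp_deriv derivative_eq_intros)
    then have mass: "\<rho>\<^sub>t r t + (\<rho>\<^sub>r r t * u r t + \<rho> r t * u\<^sub>r r t) + (real n - 1) / r * (\<rho> r t * u r t) = 0"
      and momentum: "\<rho>\<^sub>t r t * u r t + \<rho> r t * u\<^sub>t r t + (\<rho>\<^sub>r r t * (u r t)\<^sup>2 + 2 * \<rho> r t * u r t * u\<^sub>r r t)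
        + (real n - 1) / r * (\<rho> r t * (u r t)\<^sup>2) = 0"
      using sol rt by (auto simp: classical_solution_def)
    \<comment> \<open>Naming the quotient makes the remaining identity polynomial;
      \<open>(real n - 1) / (2 * r) = g / 2\<close> holds at r = 0 too, both sides being 0
      there.\<close>
    define g where "g = (real n - 1) / r"
    have g: "(real n - 1) / (2 * r) = g / 2"
      by (simp add: g_def)
    have "\<rho>\<^sub>t r t * (u r t)\<^sup>2 / 2 + \<rho> r t * u r t * u\<^sub>t r t +
        (\<rho>\<^sub>r r t * (u r t)^3 / 2 + 3 * \<rho> r t * (u r t)\<^sup>2 * u\<^sub>r r t / 2) + g / 2 * \<rho> r t * (u r t)^3 =
      u r t * (\<rho>\<^sub>t r t * u r t + \<rho> r t * u\<^sub>t r t + (\<rho>\<^sub>r r t * (u r t)\<^sup>2 + 2 * \<rho> r t * u r t * u\<^sub>r r t)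
        + g * (\<rho> r t * (u r t)\<^sup>2)) -
      (u r t)\<^sup>2 / 2 * (\<rho>\<^sub>t r t + (\<rho>\<^sub>r r t * u r t + \<rho> r t * u\<^sub>r r t) + g * (\<rho> r t * u r t))"
      by (simp add: field_simps power2_eq_square power3_eq_cube)
    then show "\<rho>\<^sub>t r t * (u r t)\<^sup>2 / 2 + \<rho> r t * u r t * u\<^sub>t r t +
        (\<rho>\<^sub>r r t * (u r t)^3 / 2 + 3 * \<rho> r t * (u r t)\<^sup>2 * u\<^sub>r r t / 2)
        + (real n - 1) / (2 * r) * \<rho> r t * (u r t)^3 = 0"
      using mass momentum by (simp add: g flip: g_def)
  qed
qed

lemma test_functionE:
  assumes "test_function S \<phi>"
  obtains \<phi>\<^sub>r \<phi>\<^sub>t K where "partials_on UNIV \<phi> \<phi>\<^sub>r \<phi>\<^sub>t" "compact K" "K \<subseteq> S"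
    "\<And>r t. (r, t) \<notin> K \<Longrightarrow> \<phi> r t = 0 \<and> \<phi>\<^sub>r r t = 0 \<and> \<phi>\<^sub>t r t = 0"
proof -
  obtain D K where D: "D 0 0 = \<phi>" "\<And>i j. continuous_on UNIV (\<lambda>(r, t). D i j r t)"
    "\<And>i j r t. ((\<lambda>x. D i j x t) has_real_derivative D (Suc i) j r t) (at r)"
    "\<And>i j r t. ((\<lambda>s. D i j r s) has_real_derivative D i (Suc j) r t) (at t)"
    and K: "compact K" "K \<subseteq> S" "\<And>r t. (r, t) \<notin> K \<Longrightarrow> \<phi> r t = 0"
    using assms unfolding test_function_def smooth_field_def by metis
  have p: "partials_on UNIV \<phi> (D 1 0) (D 0 1)"
    using D(2)[of 1 0] D(2)[of 0 1] D(3,4)[of 0 0] D(1) by (auto simp: partials_on_def)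
  have "D 1 0 r t = 0 \<and> D 0 1 r t = 0" if "(r, t) \<notin> K" for r t
  proof -
    have o: "open ((\<lambda>x. (x, t)) -` (- K))" "open ((\<lambda>s. (r, s)) -` (- K))"
      using compact_imp_closed[OF K(1)] by (auto intro!: open_vimage continuous_intros)
    have "((\<lambda>x. \<phi> x t) has_real_derivative 0) (at r)"
      by (rule has_field_derivative_transform_within_open[OF DERIV_const[of 0] o(1)])
        (use that K(3) in auto)
    moreover have "((\<lambda>s. \<phi> r s) has_real_derivative 0) (at t)"
      by (rule has_field_derivative_transform_within_open[OF DERIV_const[of 0] o(2)])
        (use that K(3) in auto)
    ultimately show ?thesis
      using partials_onD[OF p, of r t] DERIV_unique by auto
  qed
  then show thesis
    using that[OF p K(1,2)] K(3) by blast
qed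

text \<open>With the derivatives of the test function as parameters, the \<open>deriv\<close> terms
  of the weak form become fields of known continuity and support.\<close>

locale energy_test =
  fixes n :: nat and U K :: "(real \<times> real) set" and \<phi> \<phi>\<^sub>r \<phi>\<^sub>t :: field
  assumes open_U: "open U" and closed_K: "closed K" and K_sub: "K \<subseteq> U"
    and \<phi>: "partials_on UNIV \<phi> \<phi>\<^sub>r \<phi>\<^sub>t"
    and zero: "\<And>r t. (r, t) \<notin> K \<Longrightarrow> \<phi> r t = 0 \<and> \<phi>\<^sub>r r t = 0 \<and> \<phi>\<^sub>t r t = 0"
begin

definition weak_energy_density :: "field \<Rightarrow> field \<Rightarrow> field" where
  "weak_energy_density \<rho> u r t =
     - (1 / 2 * \<rho> r t * (u r t)^2) * \<phi>\<^sub>t r t - (1 / 2 * \<rho> r t * (u r t)^3) * \<phi>\<^sub>r r t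
       + (real n - 1) / (2 * r) * \<rho> r t * (u r t)^3 * \<phi> r t"

lemma continuous_on_times_test:
  assumes "continuous_on (T \<inter> U) (\<lambda>(r, t). f r t)"
  shows "continuous_on T (\<lambda>(r, t). f r t * \<phi> r t)"
    and "continuous_on T (\<lambda>(r, t). f r t * \<phi>\<^sub>r r t)"
    and "continuous_on T (\<lambda>(r, t). f r t * \<phi>\<^sub>t r t)"
proof -
  have c: "continuous_on T (\<lambda>(r, t). \<phi> r t)" "continuous_on T (\<lambda>(r, t). \<phi>\<^sub>r r t)"
    "continuous_on T (\<lambda>(r, t). \<phi>\<^sub>t r t)"
    using \<phi> partials_on_continuous[OF open_UNIV \<phi>]
    by (auto simp: partials_on_def intro: continuous_on_subset)
  note cut = continuous_on_cutoff[OF assms _ open_U closed_K K_sub]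
  show "continuous_on T (\<lambda>(r, t). f r t * \<phi> r t)"
    using cut[OF c(1)] zero by (auto simp: case_prod_unfold)
  show "continuous_on T (\<lambda>(r, t). f r t * \<phi>\<^sub>r r t)"
    using cut[OF c(2)] zero by (auto simp: case_prod_unfold)
  show "continuous_on T (\<lambda>(r, t). f r t * \<phi>\<^sub>t r t)"
    using cut[OF c(3)] zero by (auto simp: case_prod_unfold)
qed

text \<open>This is (v E - F) \<phi> with energy density E and energy flux F: the transport F - v E
  relative to a frame of speed v, with the sign it receives in the weak form.\<close>

definition flux :: "real \<Rightarrow> field \<Rightarrow> field \<Rightarrow> field" where
  "flux v \<rho> u r t = (v * (1 / 2 * \<rho> r t * (u r t)\<^sup>2) - 1 / 2 * \<rho> r t * (u r t)^3) * \<phi> r t"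

text \<open>By the energy balance the source term cancels, and the density is minus the divergence
  of (E \<phi>, F \<phi>); only boundary fluxes survive. \<open>W\<close> may reach beyond
  \<open>U\<close>: the balance is used on \<open>K\<close>, and elsewhere both sides
  vanish.\<close>

lemma
  assumes "open W" and "classical_solution n (W \<inter> U) \<rho> u"
  shows continuous_on_weak_energy_density: "continuous_on W (\<lambda>(r, t). weak_energy_density \<rho> u r t)"
    and integral_weak_energy_density: "a \<le> b \<Longrightarrow> c \<le> d \<Longrightarrow> (\<And>x t. a \<le> x \<Longrightarrow> x \<le> b \<Longrightarrow> (R + v * t + x, t) \<in> W) \<Longrightarrow>
      (\<And>x. \<phi> (R + v * c + x) c = 0) \<Longrightarrow> (\<And>x. \<phi> (R + v * d + x) d = 0) \<Longrightarrow>
      integral (cbox (a, c) (b, d)) (\<lambda>(x, t). weak_energy_density \<rho> u (R + v * t + x) t) =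
        integral {c..d} (\<lambda>t. flux v \<rho> u (R + v * t + b) t) -
        integral {c..d} (\<lambda>t. flux v \<rho> u (R + v * t + a) t)"
proof -
  have WU: "open (W \<inter> U)"
    using assms(1) open_U by auto
  obtain E\<^sub>r E\<^sub>t F\<^sub>r F\<^sub>t where
    E: "partials_on (W \<inter> U) (\<lambda>r t. 1 / 2 * \<rho> r t * (u r t)\<^sup>2) E\<^sub>r E\<^sub>t"
    and F: "partials_on (W \<inter> U) (\<lambda>r t. 1 / 2 * \<rho> r t * (u r t)^3) F\<^sub>r F\<^sub>t"
    and eq: "\<And>r t. (r, t) \<in> W \<inter> U \<Longrightarrow> E\<^sub>t r t + F\<^sub>r r t + (real n - 1) / (2 * r) * \<rho> r t * (u r t)^3 = 0"
    by (rule energy_balance[OF WU assms(2)]) blast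
  note P = partials_on_cutoff[OF E \<phi> assms(1) open_U closed_K K_sub zero]
    and Q = partials_on_cutoff[OF F \<phi> assms(1) open_U closed_K K_sub zero]
  let ?P\<^sub>t = "\<lambda>r t. E\<^sub>t r t * \<phi> r t + 1 / 2 * \<rho> r t * (u r t)\<^sup>2 * \<phi>\<^sub>t r t"
    and ?Q\<^sub>r = "\<lambda>r t. F\<^sub>r r t * \<phi> r t + 1 / 2 * \<rho> r t * (u r t)^3 * \<phi>\<^sub>r r t"
  have density: "weak_energy_density \<rho> u r t = - (?P\<^sub>t r t + ?Q\<^sub>r r t)" if "(r, t) \<in> W" for r t
  proof (cases "(r, t) \<in> K")
    case True
    then have "(real n - 1) / (2 * r) * \<rho> r t * (u r t)^3 = - (E\<^sub>t r t + F\<^sub>r r t)"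
      using eq[of r t] that K_sub by auto
    then show ?thesis
      unfolding weak_energy_density_def by (simp only:) (simp add: algebra_simps)
  next
    case False
    then show ?thesis
      using zero[OF False] by (simp add: weak_energy_density_def)
  qed
  have "continuous_on W (\<lambda>(r, t). ?P\<^sub>t r t)" "continuous_on W (\<lambda>(r, t). ?Q\<^sub>r r t)"
    using P Q unfolding partials_on_def by blast+
  then have "continuous_on W (\<lambda>p. - (?P\<^sub>t (fst p) (snd p) + ?Q\<^sub>r (fst p) (snd p)))"
    unfolding case_prod_unfold by (rule continuous_on_minus[OF continuous_on_add])
  then show "continuous_on W (\<lambda>(r, t). weak_energy_density \<rho> u r t)"
    by (rule continuous_on_eq) (auto simp: density)
  assume ab: "a \<le> b" and cd: "c \<le> d"
    and W: "\<And>x t. a \<le> x \<Longrightarrow> x \<le> b \<Longrightarrow> (R + v * t + x, t) \<in> W"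
    and z: "\<And>x. \<phi> (R + v * c + x) c = 0" "\<And>x. \<phi> (R + v * d + x) d = 0"
  have "integral (cbox (a, c) (b, d)) (\<lambda>(x, t). weak_energy_density \<rho> u (R + v * t + x) t) =
      integral (cbox (a, c) (b, d)) (\<lambda>p. - (case p of (x, t) \<Rightarrow> ?P\<^sub>t (R + v * t + x) t + ?Q\<^sub>r (R + v * t + x) t))"
    by (rule integral_cong) (auto simp: cbox_Pair_eq density W)
  also have "\<dots> = - integral (cbox (a, c) (b, d)) (\<lambda>(x, t). ?P\<^sub>t (R + v * t + x) t + ?Q\<^sub>r (R + v * t + x) t)"
    by (rule integral_neg)
  also have "integral (cbox (a, c) (b, d)) (\<lambda>(x, t). ?P\<^sub>t (R + v * t + x) t + ?Q\<^sub>r (R + v * t + x) t) =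
      integral {c..d} (\<lambda>t. - flux v \<rho> u (R + v * t + b) t) -
      integral {c..d} (\<lambda>t. - flux v \<rho> u (R + v * t + a) t)"
    by (subst moving_frame_divergence[OF assms(1) P Q ab cd W])
      (simp_all only: z mult_zero_right flux_def, simp_all add: algebra_simps)
  finally show "integral (cbox (a, c) (b, d)) (\<lambda>(x, t). weak_energy_density \<rho> u (R + v * t + x) t) =
        integral {c..d} (\<lambda>t. flux v \<rho> u (R + v * t + b) t) -
        integral {c..d} (\<lambda>t. flux v \<rho> u (R + v * t + a) t)"
    by simp
qed

end

subsection \<open>The strength of the shadow wave\<close>

lemma front_times_downward:
  assumes "R > 0" and "T \<in> front_times R v" and "0 \<le> s" "s \<le> T"
  shows "s \<in> front_times R v"
proof (cases "v \<ge> 0")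
  case True
  then show ?thesis
    using assms by (simp add: front_times_def add_pos_nonneg)
next
  case False
  then have "v * T \<le> v * s"
    using assms by (intro mult_left_mono_neg) auto
  then show ?thesis
    using assms by (simp add: front_times_def)
qed

text \<open>Front times are relatively open in the half-line t \<ge> 0, so none is the last. This
  makes room for two-sided derivatives at positive times and yields a positive front time after
  0.\<close>

lemma front_times_upward:
  assumes "t \<in> front_times R v"
  obtains T where "t < T" and "T \<in> front_times R v"
proof -
  have "open {s. 0 < R + v * s}"
    by (intro open_Collect_less continuous_intros)
  then obtain e where e: "e > 0" "\<And>s. \<bar>s - t\<bar> < e \<Longrightarrow> 0 < R + v * s"
    using assms unfolding open_dist by (auto simp: front_times_def dist_real_def)
  show thesis
    using that[of "t + e / 2"] e(2)[of "t + e / 2"] \<open>e > 0\<close> assms by (simp add: front_times_def)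
qed

lemma open_domain_of_front: "open (domain_of_front R v)"
proof -
  have "domain_of_front R v = {p. 0 < fst p} \<inter> {p. 0 < snd p} \<inter> {p. 0 < R + v * snd p}"
    by (auto simp: domain_of_front_def)
  then show ?thesis
    by (simp only:) (intro open_Int open_Collect_less continuous_intros)
qed

text \<open>The roots enter only through \<open>kappa2_eq\<close>, which both of them satisfy, so
  strength and limit are treated once for both. \<open>v \<noteq> 0\<close> gives meaning to the
  division by \<open>v\<close> in the strength.\<close>

locale shadow_front =
  fixes n :: nat and R v :: real and \<rho>\<^sub>0 u\<^sub>0 \<rho>\<^sub>1 u\<^sub>1 :: field
  assumes n: "n \<ge> 1" and R: "R > 0"
    and left: "state_on n (left_region R v) (left_region_closed R v) \<rho>\<^sub>0 u\<^sub>0"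
    and right: "state_on n (right_region R v) (right_region_closed R v) \<rho>\<^sub>1 u\<^sub>1"
    and v: "v \<noteq> 0"
    and kappa2_eq: "\<And>t. t \<in> front_times R v \<Longrightarrow>
      kappa2 R v \<rho>\<^sub>0 u\<^sub>0 \<rho>\<^sub>1 u\<^sub>1 t = v * kappa1 R v \<rho>\<^sub>0 u\<^sub>0 \<rho>\<^sub>1 u\<^sub>1 t"
begin

abbreviation U :: "(real \<times> real) set" where
  "U \<equiv> domain_of_front R v"

abbreviation \<kappa> :: "real \<Rightarrow> real" where
  "\<kappa> \<equiv> kappa1 R v \<rho>\<^sub>0 u\<^sub>0 \<rho>\<^sub>1 u\<^sub>1"

abbreviation \<sigma> :: "real \<Rightarrow> real" where
  "\<sigma> \<equiv> shadow_strength n R v \<rho>\<^sub>0 u\<^sub>0 \<rho>\<^sub>1 u\<^sub>1"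

lemma continuous_on_front:
  shows "continuous_on (front_times R v) (on_front R v \<rho>\<^sub>0)"
    and "continuous_on (front_times R v) (on_front R v u\<^sub>0)"
    and "continuous_on (front_times R v) (on_front R v \<rho>\<^sub>1)"
    and "continuous_on (front_times R v) (on_front R v u\<^sub>1)"
proof -
  have c: "continuous_on (front_times R v) (on_front R v f)"
    if "continuous_on S (\<lambda>(r, t). f r t)" "\<And>t. t \<in> front_times R v \<Longrightarrow> (R + v * t, t) \<in> S"
    for f :: field and S
    unfolding on_front_def
    by (rule continuous_on_compose2[OF that(1)[unfolded case_prod_unfold],
          of _ "\<lambda>t. (R + v * t, t)", simplified])
      (auto intro!: continuous_intros that(2))
  have "(R + v * t, t) \<in> left_region_closed R v" "(R + v * t, t) \<in> right_region_closed R v"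
    if "t \<in> front_times R v" for t
    using that by (auto simp: left_region_closed_def right_region_closed_def front_times_def)
  note l = c[OF _ this(1)] and r = c[OF _ this(2)]
  show "continuous_on (front_times R v) (on_front R v \<rho>\<^sub>0)"
    and "continuous_on (front_times R v) (on_front R v u\<^sub>0)"
    using left unfolding state_on_def by (blast intro: l)+
  show "continuous_on (front_times R v) (on_front R v \<rho>\<^sub>1)"
    and "continuous_on (front_times R v) (on_front R v u\<^sub>1)"
    using right unfolding state_on_def by (blast intro: r)+
qed

lemma kappa_eq:
  "\<kappa> t = v * (on_front R v \<rho>\<^sub>1 t - on_front R v \<rho>\<^sub>0 t)
    - (on_front R v \<rho>\<^sub>1 t * on_front R v u\<^sub>1 t - on_front R v \<rho>\<^sub>0 t * on_front R v u\<^sub>0 t)"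
  unfolding kappa1_def jump_def on_front_def ..

lemma continuous_on_kappa: "continuous_on (front_times R v) \<kappa>"
proof -
  note c = continuous_on_front
  have "continuous_on (front_times R v) (\<lambda>t. v * (on_front R v \<rho>\<^sub>1 t - on_front R v \<rho>\<^sub>0 t)
      - (on_front R v \<rho>\<^sub>1 t * on_front R v u\<^sub>1 t - on_front R v \<rho>\<^sub>0 t * on_front R v u\<^sub>0 t))"
    by (rule continuous_on_diff[OF continuous_on_mult[OF continuous_on_const continuous_on_diff[OF c(3,1)]]
          continuous_on_diff[OF continuous_on_mult[OF c(3,4)] continuous_on_mult[OF c(1,2)]]])
  then show ?thesis
    by (rule continuous_on_eq) (rule kappa_eq[symmetric])
qed

text \<open>Substituting r = R + v s turns this into the integral of \<kappa>(s) (R + v s)^(n - 1)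
  over s from 0 to t. The factor \<open>1 / v\<close> and the orientation of the integral together
  cover fronts moving in either direction.\<close>

definition accumulated :: "real \<Rightarrow> real" where
  "accumulated t = 1 / v * (LBINT r=R..R + v * t. \<kappa> ((r - R) / v) * r ^ (n - 1))"

lemma strength_eq: "\<sigma> t = accumulated t / (R + v * t) ^ (n - 1)"
proof -
  have "1 - int n = - int (n - 1)"
    using n by simp
  then have "(R + v * t) powi (1 - int n) = inverse ((R + v * t) ^ (n - 1))"
    by (simp only: power_int_minus power_int_of_nat)
  then show ?thesis
    by (simp add: shadow_strength_def accumulated_def divide_inverse)
qed

text \<open>Fundamental theorem of calculus in r followed by the chain rule, whose factor
  \<open>v\<close> cancels \<open>1 / v\<close>. Working within \<open>{0..T}\<close> keeps to times
  at which \<kappa> is continuous; \<open>a\<close> and \<open>b\<close> are the endpoints of the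
  front's path in increasing order, whatever the sign of \<open>v\<close>.\<close>

lemma DERIV_accumulated_within:
  assumes T: "T \<in> front_times R v" and t: "t \<in> {0..T}"
  shows "(accumulated has_real_derivative \<kappa> t * (R + v * t) ^ (n - 1)) (at t within {0..T})"
proof -
  let ?k = "\<lambda>r. \<kappa> ((r - R) / v) * r ^ (n - 1)"
  define I where "I x = (LBINT r=R..x. ?k r)" for x :: real
  define a b where "a = min R (R + v * T)" and "b = max R (R + v * T)"
  have between: "R + v * s \<in> {a..b} \<longleftrightarrow> s \<in> {0..T}" for s
  proof (cases "v > 0")
    case True
    then show ?thesis
      using t by (auto simp: a_def b_def min_def max_def mult_le_0_iff zero_le_mult_iff)
  next
    case False
    then have "v < 0" using v by simp
    then show ?thesis
      using t by (auto simp: a_def b_def min_def max_def mult_le_0_iff zero_le_mult_iff)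
  qed
  have time: "(r - R) / v \<in> {0..T}" if "r \<in> {a..b}" for r
    using between[of "(r - R) / v"] that v by simp
  have "continuous_on {a..b} (\<lambda>r. \<kappa> ((r - R) / v))"
  proof (rule continuous_on_compose2[OF continuous_on_kappa])
    show "continuous_on {a..b} (\<lambda>r. (r - R) / v)"
      using v by (intro continuous_intros) auto
    show "(\<lambda>r. (r - R) / v) ` {a..b} \<subseteq> front_times R v"
      using time front_times_downward[OF R T] by fastforce
  qed
  then have cont: "continuous_on {a..b} ?k"
    by (intro continuous_intros)
  have r: "R + v * t \<in> {a..b}"
    using between t by blast
  have "(I has_vector_derivative ?k (R + v * t)) (at (R + v * t) within {a..b})"
    unfolding I_def using r by (intro interval_integral_FTC2[OF _ _ cont]) (auto simp: a_def b_def)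
  then have "(I has_real_derivative ?k (R + v * t)) (at (R + v * t) within (\<lambda>t. R + v * t) ` {0..T})"
    unfolding has_real_derivative_iff_has_vector_derivative[symmetric]
    by (rule has_field_derivative_subset) (use between in blast)
  moreover have "((\<lambda>t. R + v * t) has_real_derivative v) (at t within {0..T})"
    by (auto intro!: derivative_eq_intros)
  ultimately have "(I \<circ> (\<lambda>t. R + v * t) has_real_derivative ?k (R + v * t) * v) (at t within {0..T})"
    by (rule DERIV_image_chain)
  then have "((\<lambda>t. 1 / v * I (R + v * t)) has_real_derivative 1 / v * (?k (R + v * t) * v))
      (at t within {0..T})"
    unfolding comp_def by (rule DERIV_cmult)
  moreover have "accumulated = (\<lambda>t. 1 / v * I (R + v * t))"
    by (simp add: accumulated_def I_def fun_eq_iff)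
  ultimately show ?thesis
    using v by simp
qed

text \<open>The factor multiplying \<open>\<kappa> s\<close> is positive at front times, so a
  constant sign of \<kappa> passes to the strength at every positive time.\<close>

lemma strength_mean_value:
  assumes T: "T \<in> front_times R v" and "0 < T"
  obtains s where "0 < s" "s < T" "\<sigma> T = \<kappa> s * ((R + v * s) ^ (n - 1) * T / (R + v * T) ^ (n - 1))"
proof -
  obtain s where s: "s \<in> {0<..<T}" "accumulated T - accumulated 0 = \<kappa> s * (R + v * s) ^ (n - 1) * (T - 0)"
    using mvt_simple[OF \<open>0 < T\<close>, of accumulated "\<lambda>t h. \<kappa> t * (R + v * t) ^ (n - 1) * h"]
      DERIV_accumulated_within[OF T]
    by (force simp: has_field_derivative_def)
  moreover have "accumulated 0 = 0"
    by (simp add: accumulated_def)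
  ultimately show thesis
    using that[of s] by (simp add: strength_eq)
qed

lemma DERIV_strength:
  assumes t: "t \<in> front_times R v" and "0 < t"
  shows "(\<sigma> has_real_derivative \<kappa> t - (real n - 1) * v / (R + v * t) * \<sigma> t) (at t)"
proof -
  let ?c = "R + v * t"
  obtain T where T: "t < T" "T \<in> front_times R v"
    using front_times_upward[OF t] .
  have "at t within {0..T} = at t"
    using \<open>0 < t\<close> T by (intro at_within_interior) auto
  then have acc: "(accumulated has_real_derivative \<kappa> t * ?c ^ (n - 1)) (at t)"
    using DERIV_accumulated_within[OF T(2), of t] \<open>0 < t\<close> T(1) by simp
  have c: "?c > 0"
    using t by (simp add: front_times_def)
  have "((\<lambda>t. (R + v * t) ^ (n - 1)) has_real_derivative real (n - 1) * (v * ?c ^ (n - 1 - 1))) (at t)"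
    by (auto intro!: derivative_eq_intros)
  \<comment> \<open>The case \<open>n = 1\<close> is separate because the exponent
    \<open>n - 1 - 1\<close> is truncated there; both sides are then zero.\<close>
  moreover have "real (n - 1) * (v * ?c ^ (n - 1 - 1)) = (real n - 1) * v * ?c ^ (n - 1) / ?c"
    using c n by (cases "n - 1") (auto simp: of_nat_diff)
  ultimately have "((\<lambda>t. (R + v * t) ^ (n - 1)) has_real_derivative
      (real n - 1) * v * ?c ^ (n - 1) / ?c) (at t)"
    by simp
  from DERIV_divide[OF acc this]
  have "((\<lambda>t. accumulated t / (R + v * t) ^ (n - 1)) has_real_derivative
      (\<kappa> t * ?c ^ (n - 1) * ?c ^ (n - 1) - accumulated t * ((real n - 1) * v * ?c ^ (n - 1) / ?c))
        / (?c ^ (n - 1) * ?c ^ (n - 1))) (at t)"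
    using c by simp
  moreover have "(k * p * p - A * (m * v * p / c)) / (p * p) = k - m * v / c * (A / p)"
    if "p \<noteq> 0" "c \<noteq> 0" for k p A m c :: real
    using that by (simp add: field_simps)
  ultimately show ?thesis
    using c by (simp add: strength_eq[abs_def])
qed

lemma physicalI:
  assumes "\<And>t. t \<in> front_times R v \<Longrightarrow> 0 < \<kappa> t"
  shows "physical n R v \<rho>\<^sub>0 u\<^sub>0 \<rho>\<^sub>1 u\<^sub>1"
  unfolding physical_def
proof
  fix t assume t: "t \<in> front_times R v"
  show "0 \<le> \<sigma> t"
  proof (cases "t = 0")
    case True
    then show ?thesis by (simp add: strength_eq accumulated_def)
  next
    case False
    then have "0 < t" using t by (simp add: front_times_def)
    then obtain s where s: "0 < s" "s < t"
      "\<sigma> t = \<kappa> s * ((R + v * s) ^ (n - 1) * t / (R + v * t) ^ (n - 1))"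
      using strength_mean_value[OF t] by metis
    have "s \<in> front_times R v"
      using front_times_downward[OF R t] s by simp
    then have "0 < \<kappa> s" "0 < R + v * s" "0 < R + v * t"
      using assms t by (auto simp: front_times_def)
    then show ?thesis
      unfolding s(3) using \<open>0 < t\<close> by simp
  qed
qed

lemma not_physicalI:
  assumes "\<And>t. t \<in> front_times R v \<Longrightarrow> \<kappa> t < 0"
  shows "\<not> physical n R v \<rho>\<^sub>0 u\<^sub>0 \<rho>\<^sub>1 u\<^sub>1"
proof
  assume phys: "physical n R v \<rho>\<^sub>0 u\<^sub>0 \<rho>\<^sub>1 u\<^sub>1"
  \<comment> \<open>The strength vanishes at t = 0, so the contradiction needs a positive
    time.\<close>
  have "0 \<in> front_times R v"
    using R by (simp add: front_times_def)
  then obtain t where t: "0 < t" "t \<in> front_times R v"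
    by (rule front_times_upward)
  obtain s where s: "0 < s" "s < t"
    "\<sigma> t = \<kappa> s * ((R + v * s) ^ (n - 1) * t / (R + v * t) ^ (n - 1))"
    using strength_mean_value[OF t(2,1)] by metis
  have "s \<in> front_times R v"
    using front_times_downward[OF R t(2)] s by simp
  then have "\<kappa> s < 0" "0 < R + v * s" "0 < R + v * t"
    using assms t by (auto simp: front_times_def)
  then have "\<sigma> t < 0"
    unfolding s(3) using t(1) by (intro mult_neg_pos) auto
  moreover have "0 \<le> \<sigma> t"
    using phys t(2) by (simp add: physical_def)
  ultimately show False by simp
qed

subsection \<open>The limit of the energy production\<close>

text \<open>Given \<kappa>2 = v \<kappa>1, this is the left side of the dissipativity condition
  minus its right side, in factored form.\<close>

definition dissipation :: "real \<Rightarrow> real" where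
  "dissipation t = (v - on_front R v u\<^sub>0 t) * (v - on_front R v u\<^sub>1 t) * \<kappa> t"

lemma partials_on_strength:
  "partials_on U (\<lambda>r t. \<sigma> t) (\<lambda>r t. 0) (\<lambda>r t. \<kappa> t - (real n - 1) * v / (R + v * t) * \<sigma> t)"
proof -
  have times: "t \<in> front_times R v" "0 < t" "R + v * t \<noteq> 0" if "(r, t) \<in> U" for r t
    using that by (auto simp: domain_of_front_def front_times_def)
  have "continuous_on U (\<lambda>p. \<sigma> (snd p))"
  proof (rule continuous_on_compose2[of "front_times R v \<inter> {0<..}" \<sigma>])
    show "continuous_on (front_times R v \<inter> {0<..}) \<sigma>"
      using DERIV_strength by (intro continuous_at_imp_continuous_on ballI) (auto intro: DERIV_isCont)
  qed (use times in \<open>auto intro!: continuous_intros\<close>)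
  moreover have "continuous_on U (\<lambda>p. \<kappa> (snd p))"
    by (rule continuous_on_compose2[OF continuous_on_kappa])
      (use times in \<open>auto intro!: continuous_intros\<close>)
  ultimately have "continuous_on U (\<lambda>p. \<kappa> (snd p) - (real n - 1) * v / (R + v * snd p) * \<sigma> (snd p))"
    using times by (intro continuous_intros) auto
  then show ?thesis
    using DERIV_strength times unfolding partials_on_def case_prod_unfold by auto
qed

text \<open>Besides the limit, continuity of the integrand and the location of its support are
  exported: the sign of \<open>dissipation\<close> is controlled only at front times, and strict
  positivity of the integral is obtained from continuity.\<close>

lemma weak_energy_limit:
  assumes "test_function U \<phi>"
  obtains N where "0 < N" "\<And>t. \<phi> (R + v * t) t \<noteq> 0 \<Longrightarrow> \<bar>t\<bar> < N \<and> t \<in> front_times R v"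
    "continuous_on UNIV (\<lambda>t. dissipation t * \<phi> (R + v * t) t)"
    "((\<lambda>\<epsilon>. weak_energy_production n U (shadow_density n R v \<rho>\<^sub>0 u\<^sub>0 \<rho>\<^sub>1 u\<^sub>1 \<epsilon>)
        (shadow_velocity R v u\<^sub>0 u\<^sub>1 \<epsilon>) \<phi>) \<longlongrightarrow>
      integral {- N..N} (\<lambda>t. dissipation t * \<phi> (R + v * t) t / 2)) (at_right 0)"
proof -
  obtain \<phi>\<^sub>r \<phi>\<^sub>t K where \<phi>: "partials_on UNIV \<phi> \<phi>\<^sub>r \<phi>\<^sub>t" and K: "compact K" "K \<subseteq> U"
    and zero: "\<And>r t. (r, t) \<notin> K \<Longrightarrow> \<phi> r t = 0 \<and> \<phi>\<^sub>r r t = 0 \<and> \<phi>\<^sub>t r t = 0"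
    using test_functionE[OF assms] by metis
  interpret energy_test n U K \<phi> \<phi>\<^sub>r \<phi>\<^sub>t
    using open_domain_of_front compact_imp_closed[OF K(1)] K(2) \<phi> zero by unfold_locales
  let ?w = weak_energy_density
  have w_zero: "?w \<rho> u r t = 0" if "(r, t) \<notin> K" for \<rho> u r t
    using zero[OF that] by (simp add: weak_energy_density_def)

  \<comment> \<open>One \<open>N\<close> bounds both the time and the distance from the front on the
    support, so in the moving frame the support lies inside a fixed square.\<close>
  have "bounded ((\<lambda>p. (fst p - R - v * snd p, snd p)) ` K)"
    by (intro compact_imp_bounded compact_continuous_image K(1) continuous_intros)
  then obtain N where N: "0 < N" and N': "\<And>p. p \<in> K \<Longrightarrow> norm (fst p - R - v * snd p, snd p) < N"
    unfolding bounded_pos_less by auto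
  have in_box: "\<bar>x\<bar> < N \<and> \<bar>t\<bar> < N" if "(R + v * t + x, t) \<in> K" for x t
    using N'[OF that] norm_fst_le[of x t] norm_snd_le[of t x] by simp
  have \<phi>_zero: "\<phi> (R + v * t + x) t = 0" if "\<not> (\<bar>x\<bar> < N \<and> \<bar>t\<bar> < N)" for x t
    using in_box zero that by blast

  \<comment> \<open>The open half-planes carry the differential equations; the closed ones carry the
    fluxes, which stay continuous up to the front.\<close>
  define W\<^sub>0 W\<^sub>1 where "W\<^sub>0 = {p :: real \<times> real. fst p < R + v * snd p}"
    and "W\<^sub>1 = {p :: real \<times> real. R + v * snd p < fst p}"
  define V\<^sub>0 V\<^sub>1 where "V\<^sub>0 = {p :: real \<times> real. fst p \<le> R + v * snd p}"
    and "V\<^sub>1 = {p :: real \<times> real. R + v * snd p \<le> fst p}"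
  have W: "open W\<^sub>0" "open W\<^sub>1"
    unfolding W\<^sub>0_def W\<^sub>1_def by (intro open_Collect_less continuous_intros)+
  have "W\<^sub>0 \<inter> U = left_region R v" "W\<^sub>1 \<inter> U = right_region R v"
    by (auto simp: W\<^sub>0_def W\<^sub>1_def left_region_def right_region_def)
  then have sol: "classical_solution n (W\<^sub>0 \<inter> U) \<rho>\<^sub>0 u\<^sub>0" "classical_solution n (W\<^sub>1 \<inter> U) \<rho>\<^sub>1 u\<^sub>1"
    using left right by (auto simp: state_on_def)
  have V: "V\<^sub>0 \<inter> U \<subseteq> left_region_closed R v" "V\<^sub>1 \<inter> U \<subseteq> right_region_closed R v"
    by (auto simp: V\<^sub>0_def V\<^sub>1_def left_region_closed_def right_region_closed_def
        front_times_def domain_of_front_def)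
  have flux_cont: "continuous_on T (\<lambda>(r, t). flux v \<rho> u r t)"
    if "continuous_on T' (\<lambda>(r, t). \<rho> r t)" "continuous_on T' (\<lambda>(r, t). u r t)" "T \<inter> U \<subseteq> T'"
    for T T' and \<rho> u :: field
  proof -
    have "continuous_on (T \<inter> U) (\<lambda>p. \<rho> (fst p) (snd p))" "continuous_on (T \<inter> U) (\<lambda>p. u (fst p) (snd p))"
      using that by (auto simp: case_prod_unfold intro: continuous_on_subset)
    then have "continuous_on (T \<inter> U)
        (\<lambda>(r, t). v * (1 / 2 * \<rho> r t * (u r t)\<^sup>2) - 1 / 2 * \<rho> r t * (u r t)^3)"
      unfolding case_prod_unfold by (intro continuous_intros)
    from continuous_on_times_test(1)[OF this] show ?thesis
      by (simp add: flux_def)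
  qed
  have flux_cont': "continuous_on V\<^sub>0 (\<lambda>(r, t). flux v \<rho>\<^sub>0 u\<^sub>0 r t)" "continuous_on V\<^sub>1 (\<lambda>(r, t). flux v \<rho>\<^sub>1 u\<^sub>1 r t)"
    using left right V by (auto simp: state_on_def intro: flux_cont)
  have frame: "continuous_on X (\<lambda>p. f (R + v * snd p + fst p) (snd p))"
    if "continuous_on Y (\<lambda>(r, t). f r t)" "\<And>p. p \<in> X \<Longrightarrow> (R + v * snd p + fst p, snd p) \<in> Y"
    for f :: field and X Y
    by (rule continuous_on_compose2[OF that(1)[unfolded case_prod_unfold],
          of _ "\<lambda>p. (R + v * snd p + fst p, snd p)", simplified])
      (auto intro!: continuous_intros that(2))

  \<comment> \<open>The density is linear in \<rho>, so in the strip, where \<rho> is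
    \<open>1 / \<epsilon>\<close> times the strength, it equals \<open>q / \<epsilon>\<close> and
    integrates to a mean value over the width \<epsilon>.\<close>
  define q where "q = ?w (\<lambda>r t. \<sigma> t) (\<lambda>r t. v)"
  have q_cont: "continuous_on UNIV (\<lambda>(r, t). q r t)"
  proof -
    have s: "continuous_on U (\<lambda>p. \<sigma> (snd p))"
      using partials_on_continuous[OF open_domain_of_front partials_on_strength]
      by (simp add: case_prod_unfold)
    have "fst p \<noteq> 0" if "p \<in> U" for p
      using that by (auto simp: domain_of_front_def)
    then have "continuous_on (UNIV \<inter> U) (\<lambda>(r, t). - (1 / 2 * \<sigma> t * v^2))"
      "continuous_on (UNIV \<inter> U) (\<lambda>(r, t). 1 / 2 * \<sigma> t * v^3)"
      "continuous_on (UNIV \<inter> U) (\<lambda>(r, t). (real n - 1) / (2 * r) * \<sigma> t * v^3)"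
      unfolding case_prod_unfold using s by (auto intro!: continuous_intros)
    from continuous_on_times_test(3)[OF this(1)] continuous_on_times_test(2)[OF this(2)]
      continuous_on_times_test(1)[OF this(3)]
    show ?thesis
      unfolding q_def weak_energy_density_def case_prod_unfold
      by (intro continuous_on_add continuous_on_diff)
  qed

  define B\<^sub>0 B\<^sub>1 A where "B\<^sub>0 x = integral {- N..N} (\<lambda>t. flux v \<rho>\<^sub>0 u\<^sub>0 (R + v * t + x) t)"
    and "B\<^sub>1 x = integral {- N..N} (\<lambda>t. flux v \<rho>\<^sub>1 u\<^sub>1 (R + v * t + x) t)"
    and "A x = integral {- N..N} (\<lambda>t. q (R + v * t + x) t)" for x
  have param: "continuous_on X (\<lambda>x. integral {- N..N} (\<lambda>t. f (R + v * t + x) t))"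
    if "continuous_on Y (\<lambda>(r, t). f r t)" "\<And>x t. x \<in> X \<Longrightarrow> (R + v * t + x, t) \<in> Y"
    for f :: field and X Y
    using integral_continuous_on_param[of X "- N" N "\<lambda>x t. f (R + v * t + x) t"]
      frame[OF that(1), of "X \<times> cbox (- N) N"] that(2)
    by (force simp: case_prod_unfold)
  \<comment> \<open>One-sided continuity is what the states provide, and it matches the limit:
    \<open>B\<^sub>0\<close> is evaluated at \<open>- (\<epsilon> / 2)\<close> and
    \<open>B\<^sub>1\<close> at \<open>\<epsilon> / 2\<close>.\<close>
  have B_cont: "continuous_on {..0} B\<^sub>0" "continuous_on {0..} B\<^sub>1" and A_cont: "continuous_on UNIV A"
    unfolding B\<^sub>0_def B\<^sub>1_def A_def
    by (auto intro!: param[OF flux_cont'(1)] param[OF flux_cont'(2)] param[OF q_cont]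
        simp: V\<^sub>0_def V\<^sub>1_def)

  have production: "weak_energy_production n U (shadow_density n R v \<rho>\<^sub>0 u\<^sub>0 \<rho>\<^sub>1 u\<^sub>1 \<epsilon>)
      (shadow_velocity R v u\<^sub>0 u\<^sub>1 \<epsilon>) \<phi> =
      B\<^sub>0 (- (\<epsilon> / 2)) + integral {- (\<epsilon> / 2)..\<epsilon> / 2} A / \<epsilon> - B\<^sub>1 (\<epsilon> / 2)"
    if "0 < \<epsilon>" "\<epsilon> < 2 * N" for \<epsilon>
  proof -
    let ?\<delta> = "\<epsilon> / 2"
    define g\<^sub>0 g\<^sub>m g\<^sub>1 where "g\<^sub>0 p = ?w \<rho>\<^sub>0 u\<^sub>0 (R + v * snd p + fst p) (snd p)"
      and "g\<^sub>m p = 1 / \<epsilon> * q (R + v * snd p + fst p) (snd p)"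
      and "g\<^sub>1 p = ?w \<rho>\<^sub>1 u\<^sub>1 (R + v * snd p + fst p) (snd p)" for p
    define h where "h p = (if fst p < - ?\<delta> then g\<^sub>0 p else if fst p < ?\<delta> then g\<^sub>m p else g\<^sub>1 p)" for p
    have \<delta>: "0 < ?\<delta>" "?\<delta> < N"
      using that by auto
    have g\<^sub>0: "continuous_on {p. fst p \<le> - ?\<delta>} g\<^sub>0"
      unfolding g\<^sub>0_def using \<delta>
      by (intro frame[OF continuous_on_weak_energy_density[OF W(1) sol(1)]]) (auto simp: W\<^sub>0_def)
    have g\<^sub>1: "continuous_on {p. ?\<delta> \<le> fst p} g\<^sub>1"
      unfolding g\<^sub>1_def using \<delta>
      by (intro frame[OF continuous_on_weak_energy_density[OF W(2) sol(2)]]) (auto simp: W\<^sub>1_def)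
    have g\<^sub>m: "continuous_on UNIV g\<^sub>m"
      unfolding g\<^sub>m_def by (intro continuous_on_mult continuous_on_const frame[OF q_cont]) auto
    have g_zero: "g\<^sub>0 p = 0 \<and> g\<^sub>m p = 0 \<and> g\<^sub>1 p = 0" if "p \<notin> cbox (- N, - N) (N, N)" for p
    proof -
      have "(R + v * snd p + fst p, snd p) \<notin> K"
        using in_box[of "snd p" "fst p"] that by (cases p) (auto simp: cbox_Pair_eq abs_less_iff)
      then show ?thesis
        by (simp add: g\<^sub>0_def g\<^sub>m_def g\<^sub>1_def q_def w_zero)
    qed
    note strips = integral_three_strips[OF \<delta> g\<^sub>0 g\<^sub>m g\<^sub>1 g_zero, folded h_def[abs_def]]
    have dt: "deriv (\<lambda>s. \<phi> r s) t = \<phi>\<^sub>t r t" and dr: "deriv (\<lambda>x. \<phi> x t) r = \<phi>\<^sub>r r t" for r t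
      using partials_onD[OF \<phi>, of r t] by (auto intro: DERIV_imp_deriv)
    have "indicator U (r, t) * ?w (shadow_density n R v \<rho>\<^sub>0 u\<^sub>0 \<rho>\<^sub>1 u\<^sub>1 \<epsilon>)
        (shadow_velocity R v u\<^sub>0 u\<^sub>1 \<epsilon>) r t = h (r - R - v * t, t)" for r t
    proof -
      have "?w (shadow_density n R v \<rho>\<^sub>0 u\<^sub>0 \<rho>\<^sub>1 u\<^sub>1 \<epsilon>) (shadow_velocity R v u\<^sub>0 u\<^sub>1 \<epsilon>) r t =
          h (r - R - v * t, t)"
        by (simp add: h_def g\<^sub>0_def g\<^sub>m_def g\<^sub>1_def q_def weak_energy_density_def
            shadow_density_def shadow_velocity_def algebra_simps)
      moreover have "h (r - R - v * t, t) = 0" if "(r, t) \<notin> U"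
      proof -
        have "(r, t) \<notin> K" using that K(2) by blast
        then show ?thesis by (simp add: h_def g\<^sub>0_def g\<^sub>m_def g\<^sub>1_def q_def w_zero)
      qed
      ultimately show ?thesis
        by (cases "(r, t) \<in> U") auto
    qed
    note density_eq = this
    have ends: "\<phi> (R + v * N + x) N = 0" "\<phi> (R + v * - N + x) (- N) = 0" for x
      using \<phi>_zero[of x N] \<phi>_zero[of x "- N"] N by auto
    have "weak_energy_production n U (shadow_density n R v \<rho>\<^sub>0 u\<^sub>0 \<rho>\<^sub>1 u\<^sub>1 \<epsilon>)
        (shadow_velocity R v u\<^sub>0 u\<^sub>1 \<epsilon>) \<phi> = (LINT p|lborel. (case p of (r, t) \<Rightarrow> h (r - R - v * t, t)))"
      unfolding weak_energy_production_def set_lebesgue_integral_def weak_energy_density_def dt dr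
      using density_eq[unfolded weak_energy_density_def]
      by (intro Bochner_Integration.integral_cong refl) (auto simp: split_beta)
    also have "\<dots> = integral\<^sup>L lborel h"
      by (rule integral_lborel_shear[OF strips(1)])
    also have "\<dots> = integral (cbox (- N, - N) (- ?\<delta>, N)) g\<^sub>0
        + integral (cbox (- ?\<delta>, - N) (?\<delta>, N)) g\<^sub>m + integral (cbox (?\<delta>, - N) (N, N)) g\<^sub>1"
      by (rule strips(2))
    also have "integral (cbox (- N, - N) (- ?\<delta>, N)) g\<^sub>0 = B\<^sub>0 (- ?\<delta>) - B\<^sub>0 (- N)"
      unfolding g\<^sub>0_def B\<^sub>0_def
      using integral_weak_energy_density[OF W(1) sol(1), of "- N" "- ?\<delta>" "- N" N R v] \<delta> N ends
      by (simp add: W\<^sub>0_def case_prod_unfold)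
    also have "B\<^sub>0 (- N) = 0"
      using N \<phi>_zero[of "- N"] by (simp add: B\<^sub>0_def flux_def)
    also have "integral (cbox (?\<delta>, - N) (N, N)) g\<^sub>1 = B\<^sub>1 N - B\<^sub>1 ?\<delta>"
      unfolding g\<^sub>1_def B\<^sub>1_def
      using integral_weak_energy_density[OF W(2) sol(2), of ?\<delta> N "- N" N R v] \<delta> N ends
      by (simp add: W\<^sub>1_def case_prod_unfold)
    also have "B\<^sub>1 N = 0"
      using N \<phi>_zero[of N] by (simp add: B\<^sub>1_def flux_def)
    also have "integral (cbox (- ?\<delta>, - N) (?\<delta>, N)) g\<^sub>m = integral {- ?\<delta>..?\<delta>} A / \<epsilon>"
      using integral_prod_continuous[OF continuous_on_subset[OF g\<^sub>m]]
      by (simp add: g\<^sub>m_def A_def[abs_def])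
    finally show ?thesis by simp
  qed

  have lim: "((\<lambda>\<epsilon>. B\<^sub>0 (- (\<epsilon> / 2)) + integral {- (\<epsilon> / 2)..\<epsilon> / 2} A / \<epsilon> - B\<^sub>1 (\<epsilon> / 2)) \<longlongrightarrow>
      B\<^sub>0 0 + A 0 - B\<^sub>1 0) (at_right 0)"
  proof (intro tendsto_add tendsto_diff tendsto_symmetric_mean A_cont)
    have half: "((\<lambda>\<epsilon>. \<epsilon> / 2) \<longlongrightarrow> (0::real)) (at_right 0)"
      by (auto intro!: tendsto_eq_intros)
    have pos: "\<forall>\<^sub>F \<epsilon> in at_right (0::real). 0 < \<epsilon>"
      by (rule eventually_at_right_less)
    show "((\<lambda>\<epsilon>. B\<^sub>1 (\<epsilon> / 2)) \<longlongrightarrow> B\<^sub>1 0) (at_right 0)"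
      by (rule continuous_on_tendsto_compose[OF B_cont(2) half])
        (auto intro: eventually_mono[OF pos])
    show "((\<lambda>\<epsilon>. B\<^sub>0 (- (\<epsilon> / 2))) \<longlongrightarrow> B\<^sub>0 0) (at_right 0)"
      by (rule continuous_on_tendsto_compose[OF B_cont(1) tendsto_minus[OF half, simplified]])
        (auto intro: eventually_mono[OF pos])
  qed
  \<comment> \<open>The bound \<open>2 * N\<close> keeps the half-width of the strip below
    \<open>N\<close>, as the splitting into three boxes requires.\<close>
  have "\<forall>\<^sub>F \<epsilon> in at_right 0. 0 < \<epsilon> \<and> \<epsilon> < 2 * N"
    using N by (auto simp: eventually_at_right_field intro!: exI[of _ "2 * N"])
  then have lim': "((\<lambda>\<epsilon>. weak_energy_production n U (shadow_density n R v \<rho>\<^sub>0 u\<^sub>0 \<rho>\<^sub>1 u\<^sub>1 \<epsilon>)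
      (shadow_velocity R v u\<^sub>0 u\<^sub>1 \<epsilon>) \<phi>) \<longlongrightarrow> B\<^sub>0 0 + A 0 - B\<^sub>1 0) (at_right 0)"
    by (intro Lim_transform_eventually[OF lim]) (auto elim!: eventually_mono simp: production)

  text \<open>Integration by parts along the front turns the derivatives of the test function that
    multiply the strength into the strength's growth rate.\<close>
  let ?c = "\<lambda>t. R + v * t"
  define \<sigma>' where "\<sigma>' t = \<kappa> t - (real n - 1) * v / (R + v * t) * \<sigma> t" for t
  have "partials_on UNIV (\<lambda>r t. \<sigma> t * \<phi> r t) (\<lambda>r t. 0 * \<phi> r t + \<sigma> t * \<phi>\<^sub>r r t)
      (\<lambda>r t. \<sigma>' t * \<phi> r t + \<sigma> t * \<phi>\<^sub>t r t)"
    using partials_on_strength unfolding \<sigma>'_def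
    by (intro partials_on_cutoff[OF _ \<phi> open_UNIV open_U closed_K K_sub zero]) simp_all
  note product = this
  \<comment> \<open>The total derivative of strength times test function along the front; its
    integral is zero because the test function vanishes at times \<open>- N\<close> and
    \<open>N\<close>.\<close>
  define s where "s r t = v * (\<sigma> t * \<phi>\<^sub>r r t) + (\<sigma>' t * \<phi> r t + \<sigma> t * \<phi>\<^sub>t r t)" for r t
  have s_cont: "continuous_on UNIV (\<lambda>(r, t). s r t)"
    using product unfolding partials_on_def s_def case_prod_unfold by (auto intro!: continuous_intros)
  have "((\<lambda>t. s (?c t) t) has_integral \<sigma> N * \<phi> (?c N) N - \<sigma> (- N) * \<phi> (?c (- N)) (- N)) {- N..N}"
  proof (rule fundamental_theorem_of_calculus)
    fix t
    have "((\<lambda>t. \<sigma> t * \<phi> (?c t) t) has_real_derivative s (?c t) t) (at t)"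
      using has_real_derivative_along_line[OF open_UNIV product, of R v t 0] by (simp add: s_def)
    then show "((\<lambda>t. \<sigma> t * \<phi> (?c t) t) has_vector_derivative s (?c t) t) (at t within {- N..N})"
      by (simp add: has_field_derivative_at_within flip: has_real_derivative_iff_has_vector_derivative)
  qed (use N in simp)
  then have s_int: "((\<lambda>t. s (?c t) t) has_integral 0) {- N..N}"
    using \<phi>_zero[of 0 N] \<phi>_zero[of 0 "- N"] by simp

  have line: "continuous_on X (\<lambda>t. f (?c t) t)"
    if "continuous_on Y (\<lambda>(r, t). f r t)" "\<And>t. (?c t, t) \<in> Y" for f :: field and X Y
    by (rule continuous_on_compose2[OF that(1)[unfolded case_prod_unfold],
          of _ "\<lambda>t. (?c t, t)", simplified])
      (auto intro!: continuous_intros that(2))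
  have line_cont: "continuous_on X (\<lambda>t. flux v \<rho>\<^sub>0 u\<^sub>0 (?c t) t)" "continuous_on X (\<lambda>t. flux v \<rho>\<^sub>1 u\<^sub>1 (?c t) t)"
    "continuous_on X (\<lambda>t. q (?c t) t)" "continuous_on X (\<lambda>t. s (?c t) t)" for X
    by (rule line[OF flux_cont'(1)] line[OF flux_cont'(2)] line[OF q_cont] line[OF s_cont];
        simp add: V\<^sub>0_def V\<^sub>1_def)+

  have balance: "flux v \<rho>\<^sub>0 u\<^sub>0 (?c t) t + q (?c t) t - flux v \<rho>\<^sub>1 u\<^sub>1 (?c t) t + v\<^sup>2 / 2 * s (?c t) t
      = dissipation t * \<phi> (?c t) t / 2" for t
  proof (cases "(?c t, t) \<in> K")
    case True
    then have t: "t \<in> front_times R v"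
      using K(2) by (auto simp: domain_of_front_def front_times_def)
    define a b a' b' where "a = \<rho>\<^sub>0 (?c t) t" and "b = u\<^sub>0 (?c t) t"
      and "a' = \<rho>\<^sub>1 (?c t) t" and "b' = u\<^sub>1 (?c t) t"
    have k: "\<kappa> t = v * (a' - a) - (a' * b' - a * b)"
      by (simp add: kappa_eq on_front_def a_def b_def a'_def b'_def)
    have "v * (a' * b' - a * b) - (a' * b'\<^sup>2 - a * b\<^sup>2) = v * \<kappa> t"
      using kappa2_eq[OF t] by (simp add: kappa2_def jump_def on_front_def a_def b_def a'_def b'_def)
    \<comment> \<open>Put m = a (v - b) and m' = a' (v - b'), so that \<open>\<kappa> t\<close> = m'
      - m. The relation above says m (v - b) = m' (v - b'), and both sides of the identity equal
      this common value times b' - b.\<close>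
    then have alg: "(v * (a * b\<^sup>2) - a * b^3) - (v * (a' * b'\<^sup>2) - a' * b'^3) + v\<^sup>2 * \<kappa> t
        = (v - b) * (v - b') * \<kappa> t"
      using k by algebra
    \<comment> \<open>The derivatives of the test function cancel, and the source term in
      \<open>q\<close> cancels against the \<open>n\<close>-dependent part of
      \<open>\<sigma>'\<close>; only \<kappa> remains.\<close>
    have "q (?c t) t + v\<^sup>2 / 2 * s (?c t) t = v\<^sup>2 * \<kappa> t / 2 * \<phi> (?c t) t"
    proof -
      define g where "g = (real n - 1) / ?c t"
      have "(real n - 1) / (2 * ?c t) = g / 2" and "(real n - 1) * v / ?c t = g * v"
        by (simp_all add: g_def)
      then show ?thesis
        unfolding q_def weak_energy_density_def s_def \<sigma>'_def
        by (simp only:) (simp add: field_simps power2_eq_square power3_eq_cube)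
    qed
    moreover have "flux v \<rho>\<^sub>0 u\<^sub>0 (?c t) t - flux v \<rho>\<^sub>1 u\<^sub>1 (?c t) t =
        ((v * (a * b\<^sup>2) - a * b^3) - (v * (a' * b'\<^sup>2) - a' * b'^3)) / 2 * \<phi> (?c t) t"
      by (simp add: flux_def a_def b_def a'_def b'_def field_simps)
    ultimately have "flux v \<rho>\<^sub>0 u\<^sub>0 (?c t) t + q (?c t) t - flux v \<rho>\<^sub>1 u\<^sub>1 (?c t) t + v\<^sup>2 / 2 * s (?c t) t =
        ((v * (a * b\<^sup>2) - a * b^3) - (v * (a' * b'\<^sup>2) - a' * b'^3) + v\<^sup>2 * \<kappa> t) / 2 * \<phi> (?c t) t"
      by (simp add: algebra_simps add_divide_distrib diff_divide_distrib)
    then show ?thesis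
      unfolding alg by (simp add: dissipation_def on_front_def b_def b'_def)
  next
    case False
    then show ?thesis
      using zero[OF False] w_zero[OF False] by (simp add: flux_def q_def s_def)
  qed
  have "continuous_on UNIV (\<lambda>t. 2 * (flux v \<rho>\<^sub>0 u\<^sub>0 (?c t) t + q (?c t) t - flux v \<rho>\<^sub>1 u\<^sub>1 (?c t) t
      + v\<^sup>2 / 2 * s (?c t) t))"
    by (intro continuous_on_add continuous_on_diff continuous_on_mult continuous_on_const line_cont)
  then have cont: "continuous_on UNIV (\<lambda>t. dissipation t * \<phi> (?c t) t)"
    unfolding balance by simp
  have "((\<lambda>t. flux v \<rho>\<^sub>0 u\<^sub>0 (?c t) t + q (?c t) t - flux v \<rho>\<^sub>1 u\<^sub>1 (?c t) t + v\<^sup>2 / 2 * s (?c t) t)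
      has_integral B\<^sub>0 0 + A 0 - B\<^sub>1 0 + v\<^sup>2 / 2 * 0) {- N..N}"
    unfolding B\<^sub>0_def A_def B\<^sub>1_def add_0_right
    by (intro has_integral_add has_integral_diff has_integral_mult_right s_int
        integrable_integral integrable_continuous_real line_cont)
  then have total: "B\<^sub>0 0 + A 0 - B\<^sub>1 0 = integral {- N..N} (\<lambda>t. dissipation t * \<phi> (?c t) t / 2)"
    unfolding balance mult_zero_right add_0_right by (rule integral_unique[symmetric])
  have "\<bar>t\<bar> < N \<and> t \<in> front_times R v" if "\<phi> (?c t) t \<noteq> 0" for t
  proof -
    have "(?c t, t) \<in> K"
      using that zero by blast
    then show ?thesis
      using in_box[of t 0] K(2) by (auto simp: domain_of_front_def front_times_def)
  qed
  then show thesis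
    by (rule that[OF N _ cont lim'[unfolded total]])
qed

subsection \<open>Physicality and dissipativity at the two roots\<close>

lemma dissipativeI:
  assumes "\<And>t. t \<in> front_times R v \<Longrightarrow> dissipation t \<le> 0"
  shows "dissipative n R v \<rho>\<^sub>0 u\<^sub>0 \<rho>\<^sub>1 u\<^sub>1"
  unfolding dissipative_def
proof (intro allI impI, elim conjE)
  fix \<phi> assume \<phi>: "test_function U \<phi>" and nonneg: "\<forall>r t. 0 \<le> \<phi> r t"
  obtain N where N: "0 < N" "\<And>t. \<phi> (R + v * t) t \<noteq> 0 \<Longrightarrow> \<bar>t\<bar> < N \<and> t \<in> front_times R v"
    and cont: "continuous_on UNIV (\<lambda>t. dissipation t * \<phi> (R + v * t) t)"
    and lim: "((\<lambda>\<epsilon>. weak_energy_production n U (shadow_density n R v \<rho>\<^sub>0 u\<^sub>0 \<rho>\<^sub>1 u\<^sub>1 \<epsilon>)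
        (shadow_velocity R v u\<^sub>0 u\<^sub>1 \<epsilon>) \<phi>) \<longlongrightarrow>
      integral {- N..N} (\<lambda>t. dissipation t * \<phi> (R + v * t) t / 2)) (at_right 0)"
    by (rule weak_energy_limit[OF \<phi>]) (rule that; blast)
  have "dissipation t * \<phi> (R + v * t) t / 2 \<le> 0" for t
    using N(2)[of t] assms[of t] nonneg by (cases "\<phi> (R + v * t) t = 0") (auto simp: mult_le_0_iff)
  then have "integral {- N..N} (\<lambda>t. dissipation t * \<phi> (R + v * t) t / 2) \<le> integral {- N..N} (\<lambda>_. 0)"
    by (intro integral_le integrable_continuous_real continuous_on_divide continuous_on_const
        continuous_on_subset[OF cont]) auto
  then show "\<exists>L\<le>0. ((\<lambda>\<epsilon>. weak_energy_production n U (shadow_density n R v \<rho>\<^sub>0 u\<^sub>0 \<rho>\<^sub>1 u\<^sub>1 \<epsilon>)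
        (shadow_velocity R v u\<^sub>0 u\<^sub>1 \<epsilon>) \<phi>) \<longlongrightarrow> L) (at_right 0)"
    by (intro exI[of _ "integral {- N..N} (\<lambda>t. dissipation t * \<phi> (R + v * t) t / 2)"] conjI lim) simp
qed

text \<open>A bump at a positive front time gives a continuous nonnegative integrand. If its
  integral were at most zero it would vanish identically, contrary to its value at the centre of the
  bump.\<close>

lemma not_dissipativeI:
  assumes pos: "\<And>t. t \<in> front_times R v \<Longrightarrow> 0 < dissipation t"
  shows "\<not> dissipative n R v \<rho>\<^sub>0 u\<^sub>0 \<rho>\<^sub>1 u\<^sub>1"
proof
  assume diss: "dissipative n R v \<rho>\<^sub>0 u\<^sub>0 \<rho>\<^sub>1 u\<^sub>1"
  have "0 \<in> front_times R v"
    using R by (simp add: front_times_def)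
  then obtain s where s: "0 < s" "s \<in> front_times R v"
    by (rule front_times_upward)
  then have "(R + v * s, s) \<in> U"
    by (simp add: domain_of_front_def front_times_def)
  from test_function_bump[OF open_domain_of_front this]
  obtain \<phi> where \<phi>: "test_function U \<phi>" "\<And>r t. 0 \<le> \<phi> r t" "\<phi> (R + v * s) s \<noteq> 0"
    by auto
  obtain N where N: "0 < N" "\<And>t. \<phi> (R + v * t) t \<noteq> 0 \<Longrightarrow> \<bar>t\<bar> < N \<and> t \<in> front_times R v"
    and cont: "continuous_on UNIV (\<lambda>t. dissipation t * \<phi> (R + v * t) t)"
    and lim: "((\<lambda>\<epsilon>. weak_energy_production n U (shadow_density n R v \<rho>\<^sub>0 u\<^sub>0 \<rho>\<^sub>1 u\<^sub>1 \<epsilon>)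
        (shadow_velocity R v u\<^sub>0 u\<^sub>1 \<epsilon>) \<phi>) \<longlongrightarrow>
      integral {- N..N} (\<lambda>t. dissipation t * \<phi> (R + v * t) t / 2)) (at_right 0)"
    by (rule weak_energy_limit[OF \<phi>(1)]) (rule that; blast)
  let ?f = "\<lambda>t. dissipation t * \<phi> (R + v * t) t / 2"
  have nonneg: "0 \<le> ?f t" for t
    using N(2)[of t] pos[of t] \<phi>(2)[of "R + v * t" t]
    by (cases "\<phi> (R + v * t) t = 0") (auto intro: mult_nonneg_nonneg less_imp_le)
  have f_cont: "continuous_on {- N..N} ?f"
    by (intro continuous_on_divide continuous_on_const continuous_on_subset[OF cont]) auto
  obtain L where "L \<le> 0" "((\<lambda>\<epsilon>. weak_energy_production n U (shadow_density n R v \<rho>\<^sub>0 u\<^sub>0 \<rho>\<^sub>1 u\<^sub>1 \<epsilon>)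
        (shadow_velocity R v u\<^sub>0 u\<^sub>1 \<epsilon>) \<phi>) \<longlongrightarrow> L) (at_right 0)"
    using diss \<phi>(1,2) unfolding dissipative_def by blast
  then have "integral {- N..N} ?f \<le> 0"
    using tendsto_unique[OF _ lim] by auto
  moreover have "0 \<le> integral {- N..N} ?f"
    by (intro integral_nonneg integrable_continuous_real f_cont) (rule nonneg)
  ultimately have "\<forall>t\<in>{- N..N}. ?f t = 0"
    using integral_eq_0_iff[OF f_cont] nonneg N(1) by auto
  then have "?f s = 0"
    using N(2)[OF \<phi>(3)] by (auto simp: abs_less_iff)
  then show False
    using pos[OF s(2)] \<phi>(3) by simp
qed

text \<open>The front times form an interval, so the intermediate value theorem excludes a change of
  sign without a zero.\<close>

lemma kappa_constant_sign:
  assumes "\<And>t. t \<in> front_times R v \<Longrightarrow> \<kappa> t \<noteq> 0"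
  shows "(\<forall>t\<in>front_times R v. 0 < \<kappa> t) \<or> (\<forall>t\<in>front_times R v. \<kappa> t < 0)"
proof (rule ccontr)
  assume "\<not> ?thesis"
  then obtain s t where st: "s \<in> front_times R v" "t \<in> front_times R v" "\<kappa> s \<le> 0" "0 \<le> \<kappa> t"
    by (auto simp: not_less)
  have "is_interval (front_times R v)"
    unfolding is_interval_1
  proof (intro ballI allI impI)
    fix a b x assume "a \<in> front_times R v" "b \<in> front_times R v" "a \<le> x \<and> x \<le> b"
    then show "x \<in> front_times R v"
      using front_times_downward[OF R, of b v x] by (auto simp: front_times_def)
  qed
  then have "connected (\<kappa> ` front_times R v)"
    by (rule connected_continuous_image[OF continuous_on_kappa is_interval_connected])
  then have "0 \<in> \<kappa> ` front_times R v"
    using connectedD_interval[of "\<kappa> ` front_times R v" "\<kappa> s" "\<kappa> t" 0] st by blast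
  then show False
    using assms by force
qed

lemma dissipativity_condition_iff:
  assumes "t \<in> front_times R v"
  shows "dissipativity_condition R v \<rho>\<^sub>0 u\<^sub>0 \<rho>\<^sub>1 u\<^sub>1 t \<longleftrightarrow> dissipation t \<le> 0"
proof -
  have "on_front R v u\<^sub>0 t * on_front R v u\<^sub>1 t * \<kappa> t
      - (on_front R v u\<^sub>0 t + on_front R v u\<^sub>1 t - v) * (v * \<kappa> t) = dissipation t"
    by (simp add: dissipation_def algebra_simps)
  then show ?thesis
    unfolding dissipativity_condition_def kappa2_eq[OF assms] by linarith
qed

end

section \<open>Algebra of the two roots\<close>

lemma first_root_properties:
  fixes a a' b b' v k1 k2 :: real
  assumes v_def: "v = first_root a b a' b'" and k1_def: "k1 = v * (a' - a) - (a' * b' - a * b)"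
    and k2_def: "k2 = v * (a' * b' - a * b) - (a' * b'\<^sup>2 - a * b\<^sup>2)"
    and "0 \<le> a" "0 \<le> a'" and k2: "k2 \<noteq> 0"
  shows "k2 = v * k1" "0 < k1 \<longleftrightarrow> b' < b" "(v - b) * (v - b') < 0" "v \<le> b \<and> b' \<le> v \<longleftrightarrow> b' < b"
proof -
  define s s' where "s = sqrt a" and "s' = sqrt a'"
  have a: "a = s\<^sup>2" "a' = s'\<^sup>2" and s: "0 \<le> s" "0 \<le> s'"
    using assms(4,5) by (simp_all add: s_def s'_def)
  \<comment> \<open>With vacuum on both sides the denominator of the root would be zero;
    \<open>k2 \<noteq> 0\<close> excludes this.\<close>
  have "s \<noteq> 0 \<or> s' \<noteq> 0"
    using k2 by (auto simp: k2_def a)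
  then have S: "0 < s' + s"
    using s by linarith
  then have v: "v * (s' + s) = b' * s' + b * s"
    by (simp add: v_def first_root_def s_def s'_def)
  \<comment> \<open>\<open>v\<close> is the mean of \<open>b'\<close> and \<open>b\<close> with
    weights \<open>s'\<close> and \<open>s\<close>, so it lies between the two velocities.\<close>
  have d: "(s' + s) * (v - b) = s' * (b' - b)" "(s' + s) * (v - b') = s * (b - b')"
    using v by (simp_all add: algebra_simps)
  show k2_eq: "k2 = v * k1"
    using v unfolding k1_def k2_def a by algebra
  have k1: "k1 = s * s' * (b - b')"
    using v unfolding k1_def a by algebra
  \<comment> \<open>Since \<open>k2 = v * k1\<close>, a nonzero \<open>k2\<close> forces all factors
    of \<open>k1\<close> to be nonzero: neither side is a vacuum and the velocities differ, so
    \<open>v\<close> lies strictly between them.\<close>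
  have ss: "0 < s" "0 < s'" and b: "b \<noteq> b'"
    using k2 s unfolding k2_eq k1 by auto
  have "0 < x * y \<longleftrightarrow> 0 < y" if "0 < x" for x y :: real
    using that by (auto simp: zero_less_mult_iff)
  from this[OF mult_pos_pos[OF ss], of "b - b'"] show "0 < k1 \<longleftrightarrow> b' < b"
    unfolding k1 by simp
  have e: "v - b = - (s' * (b - b') / (s' + s))" "v - b' = s * (b - b') / (s' + s)"
    using d S by (simp_all add: field_simps)
  have "(v - b) * (v - b') = - (s * s' * (b - b')\<^sup>2 / (s' + s)\<^sup>2)"
    unfolding e by (simp add: power2_eq_square ac_simps)
  also have "\<dots> < 0"
    using ss b S by simp
  finally show "(v - b) * (v - b') < 0" .
  have "v \<le> b \<longleftrightarrow> (s' + s) * (v - b) \<le> 0" "b' \<le> v \<longleftrightarrow> 0 \<le> (s' + s) * (v - b')"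
    using S by (simp_all add: mult_le_0_iff zero_le_mult_iff)
  then show "v \<le> b \<and> b' \<le> v \<longleftrightarrow> b' < b"
    unfolding d using ss b by (auto simp: mult_le_0_iff zero_le_mult_iff)
qed

lemma second_root_properties:
  fixes a a' b b' v k1 k2 :: real
  assumes v_def: "v = second_root a b a' b'" and k1_def: "k1 = v * (a' - a) - (a' * b' - a * b)"
    and k2_def: "k2 = v * (a' * b' - a * b) - (a' * b'\<^sup>2 - a * b\<^sup>2)"
    and "0 \<le> a" "0 \<le> a'" and "a \<noteq> a'" and k2: "k2 \<noteq> 0"
  shows "k2 = v * k1" "0 < (v - b) * (v - b')"
proof -
  define s s' where "s = sqrt a" and "s' = sqrt a'"
  have a: "a = s\<^sup>2" "a' = s'\<^sup>2" and s: "0 \<le> s" "0 \<le> s'"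
    using assms(4,5) by (simp_all add: s_def s'_def)
  have S: "s' - s \<noteq> 0"
    using assms(6) by (simp add: s_def s'_def)
  then have v: "v * (s' - s) = b' * s' - b * s"
    by (simp add: v_def second_root_def s_def s'_def)
  \<comment> \<open>The weights \<open>s'\<close> and \<open>- s\<close> now have opposite signs,
    which puts \<open>v\<close> outside the segment between the two velocities.\<close>
  have d: "(s' - s) * (v - b) = s' * (b' - b)" "(s' - s) * (v - b') = s * (b' - b)"
    using v by (simp_all add: algebra_simps)
  show k2_eq: "k2 = v * k1"
    using v unfolding k1_def k2_def a by algebra
  have k1: "k1 = s * s' * (b' - b)"
    using v unfolding k1_def a by algebra
  have ss: "0 < s" "0 < s'" and b: "b \<noteq> b'"
    using k2 s unfolding k2_eq k1 by auto
  have e: "v - b = s' * (b' - b) / (s' - s)" "v - b' = s * (b' - b) / (s' - s)"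
    using d S by (simp_all add: field_simps)
  have "0 < s * s' * (b' - b)\<^sup>2 / (s' - s)\<^sup>2"
    using ss b S by simp
  also have "\<dots> = (v - b) * (v - b')"
    unfolding e by (simp add: power2_eq_square)
  finally show "0 < (v - b) * (v - b')" .
qed

text \<open>At the first root \<kappa>1 has the sign of u0 - u1, so a front there with u0 < u1 has
  negative strength. Hence the equivalence carries the ordering of the velocities, while the second
  clause presupposes physicality instead. The premise of the last equivalence excludes the second
  root with \<kappa>1 < 0, where the dissipativity condition holds but overcompressibility
  fails.\<close>

theorem proposition5p3:
  fixes n :: nat and R v\<^sub>0 :: real and \<rho>\<^sub>0 u\<^sub>0 \<rho>\<^sub>1 u\<^sub>1 :: field
  assumes "n \<ge> 1" and "R > 0"
    and "state_on n (left_region R v\<^sub>0) (left_region_closed R v\<^sub>0) \<rho>\<^sub>0 u\<^sub>0"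
    and "state_on n (right_region R v\<^sub>0) (right_region_closed R v\<^sub>0) \<rho>\<^sub>1 u\<^sub>1"
    and "is_first_root R v\<^sub>0 \<rho>\<^sub>0 u\<^sub>0 \<rho>\<^sub>1 u\<^sub>1 \<or> is_second_root R v\<^sub>0 \<rho>\<^sub>0 u\<^sub>0 \<rho>\<^sub>1 u\<^sub>1"
    and "\<forall>t\<in>front_times R v\<^sub>0. kappa2 R v\<^sub>0 \<rho>\<^sub>0 u\<^sub>0 \<rho>\<^sub>1 u\<^sub>1 t \<noteq> 0"
  shows
    "(physical n R v\<^sub>0 \<rho>\<^sub>0 u\<^sub>0 \<rho>\<^sub>1 u\<^sub>1 \<and> dissipative n R v\<^sub>0 \<rho>\<^sub>0 u\<^sub>0 \<rho>\<^sub>1 u\<^sub>1 \<longleftrightarrow>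
        is_first_root R v\<^sub>0 \<rho>\<^sub>0 u\<^sub>0 \<rho>\<^sub>1 u\<^sub>1 \<and>
        (\<forall>t\<in>front_times R v\<^sub>0. on_front R v\<^sub>0 u\<^sub>0 t \<ge> on_front R v\<^sub>0 u\<^sub>1 t)) \<and>
     (physical n R v\<^sub>0 \<rho>\<^sub>0 u\<^sub>0 \<rho>\<^sub>1 u\<^sub>1 \<longrightarrow>
        (dissipative n R v\<^sub>0 \<rho>\<^sub>0 u\<^sub>0 \<rho>\<^sub>1 u\<^sub>1 \<longleftrightarrow> is_first_root R v\<^sub>0 \<rho>\<^sub>0 u\<^sub>0 \<rho>\<^sub>1 u\<^sub>1)) \<and>
     (\<forall>t\<in>front_times R v\<^sub>0. on_front R v\<^sub>0 \<rho>\<^sub>0 t > 0 \<and> on_front R v\<^sub>0 \<rho>\<^sub>1 t > 0 \<longrightarrow>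
        (physical n R v\<^sub>0 \<rho>\<^sub>0 u\<^sub>0 \<rho>\<^sub>1 u\<^sub>1 \<and> dissipative n R v\<^sub>0 \<rho>\<^sub>0 u\<^sub>0 \<rho>\<^sub>1 u\<^sub>1 \<longrightarrow>
           on_front R v\<^sub>0 u\<^sub>0 t \<ge> on_front R v\<^sub>0 u\<^sub>1 t) \<and>
        (physical n R v\<^sub>0 \<rho>\<^sub>0 u\<^sub>0 \<rho>\<^sub>1 u\<^sub>1 \<or> is_first_root R v\<^sub>0 \<rho>\<^sub>0 u\<^sub>0 \<rho>\<^sub>1 u\<^sub>1 \<longrightarrow>
           (dissipativity_condition R v\<^sub>0 \<rho>\<^sub>0 u\<^sub>0 \<rho>\<^sub>1 u\<^sub>1 t \<longleftrightarrow> overcompressive R v\<^sub>0 u\<^sub>0 u\<^sub>1 t)))"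
proof -
  define k1 k2 where "k1 = kappa1 R v\<^sub>0 \<rho>\<^sub>0 u\<^sub>0 \<rho>\<^sub>1 u\<^sub>1" and "k2 = kappa2 R v\<^sub>0 \<rho>\<^sub>0 u\<^sub>0 \<rho>\<^sub>1 u\<^sub>1"
  let ?T = "front_times R v\<^sub>0"
  let ?a = "on_front R v\<^sub>0 \<rho>\<^sub>0" and ?b = "on_front R v\<^sub>0 u\<^sub>0"
    and ?a' = "on_front R v\<^sub>0 \<rho>\<^sub>1" and ?b' = "on_front R v\<^sub>0 u\<^sub>1"
  have k1: "k1 t = v\<^sub>0 * (?a' t - ?a t) - (?a' t * ?b' t - ?a t * ?b t)"
    and k2: "k2 t = v\<^sub>0 * (?a' t * ?b' t - ?a t * ?b t) - (?a' t * (?b' t)\<^sup>2 - ?a t * (?b t)\<^sup>2)" for t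
    by (simp_all add: k1_def k2_def kappa1_def kappa2_def jump_def on_front_def)
  have T0: "0 \<in> ?T"
    using assms(2) by (simp add: front_times_def)
  have nz: "k2 t \<noteq> 0" if "t \<in> ?T" for t
    using assms(6) that by (simp add: k2_def)
  have a: "0 \<le> ?a t" "0 \<le> ?a' t" if "t \<in> ?T" for t
  proof -
    have "(R + v\<^sub>0 * t, t) \<in> left_region_closed R v\<^sub>0" "(R + v\<^sub>0 * t, t) \<in> right_region_closed R v\<^sub>0"
      using that by (auto simp: left_region_closed_def right_region_closed_def front_times_def)
    then show "0 \<le> ?a t" "0 \<le> ?a' t"
      using assms(3,4) unfolding state_on_def on_front_def by fastforce+
  qed
  have first: "k2 t = v\<^sub>0 * k1 t" "0 < k1 t \<longleftrightarrow> ?b' t < ?b t" "(v\<^sub>0 - ?b t) * (v\<^sub>0 - ?b' t) < 0"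
    "v\<^sub>0 \<le> ?b t \<and> ?b' t \<le> v\<^sub>0 \<longleftrightarrow> ?b' t < ?b t"
    if "is_first_root R v\<^sub>0 \<rho>\<^sub>0 u\<^sub>0 \<rho>\<^sub>1 u\<^sub>1" "t \<in> ?T" for t
  proof -
    have v: "v\<^sub>0 = first_root (?a t) (?b t) (?a' t) (?b' t)"
      using that by (simp add: is_first_root_def)
    show "k2 t = v\<^sub>0 * k1 t" "0 < k1 t \<longleftrightarrow> ?b' t < ?b t" "(v\<^sub>0 - ?b t) * (v\<^sub>0 - ?b' t) < 0"
      "v\<^sub>0 \<le> ?b t \<and> ?b' t \<le> v\<^sub>0 \<longleftrightarrow> ?b' t < ?b t"
      using first_root_properties[OF v k1 k2 a[OF that(2)] nz[OF that(2)]] by blast+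
  qed
  have second: "k2 t = v\<^sub>0 * k1 t" "0 < (v\<^sub>0 - ?b t) * (v\<^sub>0 - ?b' t)"
    if "is_second_root R v\<^sub>0 \<rho>\<^sub>0 u\<^sub>0 \<rho>\<^sub>1 u\<^sub>1" "t \<in> ?T" for t
  proof -
    have v: "v\<^sub>0 = second_root (?a t) (?b t) (?a' t) (?b' t)" and ne: "?a t \<noteq> ?a' t"
      using that by (simp_all add: is_second_root_def)
    show "k2 t = v\<^sub>0 * k1 t" "0 < (v\<^sub>0 - ?b t) * (v\<^sub>0 - ?b' t)"
      using second_root_properties[OF v k1 k2 a[OF that(2)] ne nz[OF that(2)]] by blast+
  qed
  have k2_eq: "k2 t = v\<^sub>0 * k1 t" if "t \<in> ?T" for t
    using assms(5) first(1) second(1) that by blast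
  have k1_nz: "k1 t \<noteq> 0" if "t \<in> ?T" for t
    using nz[OF that] k2_eq[OF that] by auto
  interpret shadow_front n R v\<^sub>0 \<rho>\<^sub>0 u\<^sub>0 \<rho>\<^sub>1 u\<^sub>1
  proof
    show "v\<^sub>0 \<noteq> 0"
      using nz[OF T0] k2_eq[OF T0] by auto
  qed (use assms k2_eq in \<open>auto simp: k1_def k2_def\<close>)
  have diss: "dissipation t = (v\<^sub>0 - ?b t) * (v\<^sub>0 - ?b' t) * k1 t" for t
    by (simp add: dissipation_def k1_def)
  have signs: "(\<forall>t\<in>?T. 0 < k1 t) \<or> (\<forall>t\<in>?T. k1 t < 0)"
    using kappa_constant_sign k1_nz unfolding k1_def by blast
  have phys: "physical n R v\<^sub>0 \<rho>\<^sub>0 u\<^sub>0 \<rho>\<^sub>1 u\<^sub>1 \<longleftrightarrow> (\<forall>t\<in>?T. 0 < k1 t)"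
    using signs physicalI not_physicalI unfolding k1_def by blast
  show ?thesis
  proof (cases "is_first_root R v\<^sub>0 \<rho>\<^sub>0 u\<^sub>0 \<rho>\<^sub>1 u\<^sub>1")
    case True
    note first = first[OF True]
    have neg_iff: "dissipation t \<le> 0 \<longleftrightarrow> 0 < k1 t" if "t \<in> ?T" for t
    proof -
      have "x * y \<le> 0 \<longleftrightarrow> 0 < y" if "x < 0" "y \<noteq> 0" for x y :: real
        using that by (auto simp: mult_le_0_iff)
      from this[OF first(3)[OF that] k1_nz[OF that]] show ?thesis
        unfolding diss .
    qed
    have "dissipative n R v\<^sub>0 \<rho>\<^sub>0 u\<^sub>0 \<rho>\<^sub>1 u\<^sub>1" if "\<forall>t\<in>?T. 0 < k1 t"
      using dissipativeI neg_iff that by blast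
    \<comment> \<open>Equal velocities are impossible at the first root, so the strict ordering
      given by the sign of \<kappa>1 agrees with the weak ordering in the claim.\<close>
    moreover have "?b' t \<noteq> ?b t" if "t \<in> ?T" for t
      using first(3)[OF that] by (auto simp: mult_less_0_iff)
    then have "(\<forall>t\<in>?T. 0 < k1 t) \<longleftrightarrow> (\<forall>t\<in>?T. ?b' t \<le> ?b t)"
      using first(2) by (meson less_le)
    moreover have "dissipativity_condition R v\<^sub>0 \<rho>\<^sub>0 u\<^sub>0 \<rho>\<^sub>1 u\<^sub>1 t \<longleftrightarrow> overcompressive R v\<^sub>0 u\<^sub>0 u\<^sub>1 t"
      if "t \<in> ?T" for t
      using first(2,4)[OF that] neg_iff[OF that] dissipativity_condition_iff[OF that]
      by (simp add: overcompressive_def)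
    ultimately show ?thesis
      using True unfolding phys by blast
  next
    case False
    then have second: "0 < (v\<^sub>0 - ?b t) * (v\<^sub>0 - ?b' t)" if "t \<in> ?T" for t
      using assms(5) second(2) that by blast
    have pos: "0 < dissipation t" if "t \<in> ?T" "0 < k1 t" for t
      unfolding diss by (rule mult_pos_pos[OF second[OF that(1)] that(2)])
    then have "\<not> dissipative n R v\<^sub>0 \<rho>\<^sub>0 u\<^sub>0 \<rho>\<^sub>1 u\<^sub>1" if "\<forall>t\<in>?T. 0 < k1 t"
      using not_dissipativeI that by blast
    \<comment> \<open>Overcompressibility would place \<open>v\<^sub>0\<close> between the two
      velocities and make the product nonpositive. For a physical wave both conditions fail at the
      second root, so they are equivalent there as well.\<close>
    moreover have "\<not> overcompressive R v\<^sub>0 u\<^sub>0 u\<^sub>1 t" if "t \<in> ?T" for t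
      using second[OF that] by (auto simp: overcompressive_def zero_less_mult_iff)
    moreover have "\<not> dissipativity_condition R v\<^sub>0 \<rho>\<^sub>0 u\<^sub>0 \<rho>\<^sub>1 u\<^sub>1 t" if "t \<in> ?T" "0 < k1 t" for t
      using pos[OF that] dissipativity_condition_iff[OF that(1)] by simp
    ultimately show ?thesis
      using False unfolding phys by blast
  qed
qed

end
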